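(* Let $p$ be a prime and $d\geq 3$ an integer. Then every sequence of length $(6p-4)p^{d-3}+1$ in $\mathbb{Z}_p^d$ contains a zero-sum subsequence of length at most $\frac{3p-1}{2}$. If $d\geq 4$, then every sequence of length $(6p-4)p^{d-4}+1$ in $\mathbb{Z}_p^d$ contains a zero-sum subsequence of length at most $2p$.
   Context: $\mathbb{Z}_p=\mathbb{Z}/p\mathbb{Z}$. A sequence is a finite sequence of elements (repetitions allowed); a zero-sum subsequence of length $\ell$ is a choice of $\ell\geq 1$ distinct indices whose corresponding terms sum to $0$. *)

theory Defs
  imports
    Complex_Main
    "HOL-Algebra.FiniteProduct"
    "HOL-Algebra.Elementary_Groups"
    "HOL-Algebra.Product_Groups"
    "HOL-Computational_Algebra.Primes"
begin

text \<open>HOL-Algebra groups are written multiplicatively: in this group the operation is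
  coordinatewise addition modulo \<open>p\<close>, the unit is the zero vector, and \<^const>\<open>finprod\<close> is the
  sum.\<close>
definition Zmod_power :: "nat \<Rightarrow> nat \<Rightarrow> (nat \<Rightarrow> int) monoid" where
  "Zmod_power p d = product_group {..<d} (\<lambda>_. integer_mod_group p)"

definition has_zero_sum_subseq :: "('a, 'b) monoid_scheme \<Rightarrow> 'a list \<Rightarrow> nat \<Rightarrow> bool" where
  "has_zero_sum_subseq G xs l \<longleftrightarrow>
     l \<ge> 1 \<and> (\<exists>I \<subseteq> {..<length xs}. card I = l \<and> finprod G (\<lambda>i. xs ! i) I = \<one>\<^bsub>G\<^esub>)"

end

theory Submission
  imports Defs "HOL-Number_Theory.Residues" "HOL-Library.Numeral_Type" "HOL-Library.Product_Plus"
begin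

text \<open>
  Among \<open>6p - 3\<close> vectors let \<open>N\<^sub>k\<close> be the number of zero-sum subsequences of length \<open>kp\<close>, with \<open>N\<^sub>0 = 1\<close>.
  The polynomial method shows \<open>\<Sum>k. (-1) ^ k * N\<^sub>k * q k = 0\<close> modulo \<open>p\<close> for every polynomial \<open>q\<close> of degree
  at most two in dimension three, and at most one in dimension four. Length \<open>5p\<close> reduces to shorter ones
  by taking complements. In dimension three \<open>q k = (k - 2) * (k - 4)\<close> forces a length \<open>p\<close> or \<open>3p\<close>, in
  dimension four \<open>q k = k - 3\<close> forces a length \<open>p\<close>, \<open>2p\<close> or \<open>4p\<close>. Zero-sum subsequences of length \<open>3p\<close>
  respectively \<open>4p\<close> exceed the Davenport constant, so they split, and the smaller part is short enough.
  For \<open>p = 3\<close> in dimension four \<open>q 0\<close> vanishes, and the geometry of lines and planes in a group of order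
  81 is used instead; \<open>p = 2\<close> in the first claim is the pigeonhole principle. In higher dimension some
  hyperplane contains so many of the vectors that the bound in one dimension less applies to it.
\<close>

subsection \<open>The polynomial method\<close>

text \<open>Vectors are integer families read modulo \<open>p\<close>. The coordinate set
  \<open>J\<close> is arbitrary, so coordinates can be added or dropped without renumbering.\<close>

definition zero_sum :: "nat \<Rightarrow> 'j set \<Rightarrow> ('i \<Rightarrow> 'j \<Rightarrow> int) \<Rightarrow> 'i set \<Rightarrow> bool" where
  "zero_sum p J x A \<longleftrightarrow> (\<forall>j\<in>J. int p dvd (\<Sum>i\<in>A. x i j))"

text \<open>Integer polynomials of degree at most \<open>m\<close> in the 0/1 membership variables
  of \<open>A\<close>: the monomial of \<open>B\<close> is the product of the variables indexed by
  \<open>B\<close>.\<close>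

inductive setpoly :: "nat \<Rightarrow> ('i set \<Rightarrow> int) \<Rightarrow> bool" for m where
  zero: "setpoly m (\<lambda>A. 0)"
| add: "setpoly m F \<Longrightarrow> finite B \<Longrightarrow> card B \<le> m \<Longrightarrow> setpoly m (\<lambda>A. F A + c * of_bool (B \<subseteq> A))"

lemma setpoly_monom: "finite B \<Longrightarrow> card B \<le> m \<Longrightarrow> setpoly m (\<lambda>A. c * of_bool (B \<subseteq> A))"
  using setpoly.add[OF setpoly.zero] by simp

lemma setpoly_const: "setpoly m (\<lambda>A. c)"
  using setpoly_monom[of "{}" m c] by simp

lemma setpoly_plus:
  assumes "setpoly m F" "setpoly m G" shows "setpoly m (\<lambda>A. F A + G A)"
  using assms(2)
proof (induction rule: setpoly.induct)
  case (add G B c)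
  then show ?case using setpoly.add[of m "\<lambda>A. F A + G A" B c] by (simp add: add.assoc)
qed (use assms in simp)

lemma setpoly_sum:
  assumes "\<And>s. s \<in> S \<Longrightarrow> setpoly m (F s)" shows "setpoly m (\<lambda>A. \<Sum>s\<in>S. F s A)"
  using assms by (induction S rule: infinite_finite_induct) (auto intro: setpoly.zero setpoly_plus)

text \<open>Membership variables are idempotent, so the monomials of \<open>B\<close> and
  \<open>C\<close> multiply to that of \<open>B \<union> C\<close>, and degrees at most add
  up.\<close>

lemma setpoly_mult_monom:
  assumes "setpoly m F" "finite C" "card C \<le> n"
  shows "setpoly (m + n) (\<lambda>A. F A * (c * of_bool (C \<subseteq> A)))"
  using assms(1)
proof (induction rule: setpoly.induct)
  case (add F B d)
  have "setpoly (m + n) (\<lambda>A. F A * (c * of_bool (C \<subseteq> A)) + (d * c) * of_bool (B \<union> C \<subseteq> A))"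
    using add assms card_Un_le[of B C] by (intro setpoly.add) auto
  moreover have "(F A + d * of_bool (B \<subseteq> A)) * (c * of_bool (C \<subseteq> A)) =
      F A * (c * of_bool (C \<subseteq> A)) + (d * c) * of_bool (B \<union> C \<subseteq> A)" for A
    by (auto simp: algebra_simps)
  ultimately show ?case by simp
qed (auto intro: setpoly.zero)

lemma setpoly_mult:
  assumes "setpoly m F" "setpoly n G" shows "setpoly (m + n) (\<lambda>A. F A * G A)"
  using assms(2)
proof (induction rule: setpoly.induct)
  case (add G B c)
  then show ?case
    using setpoly_plus[OF add.IH setpoly_mult_monom[OF assms(1), of B n c]]
    by (simp add: distrib_left)
qed (auto intro: setpoly.zero)

lemma setpoly_power: "setpoly m F \<Longrightarrow> setpoly (k * m) (\<lambda>A. F A ^ k)"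
  by (induction k) (auto intro: setpoly_mult setpoly_const[of _ 1])

lemma setpoly_prod:
  assumes "finite S" "\<And>s. s \<in> S \<Longrightarrow> setpoly m (F s)"
  shows "setpoly (card S * m) (\<lambda>A. \<Prod>s\<in>S. F s A)"
  using assms by (induction S rule: finite_induct) (auto intro: setpoly_mult setpoly_const[of _ 1])

text \<open>Pairing \<open>A\<close> with \<open>A\<close> plus or minus a fixed element outside \<open>B\<close> cancels all terms.\<close>

lemma alternating_sum_monom:
  assumes "finite I" "finite B" "card B < card I"
  shows "(\<Sum>A\<in>Pow I. (-1) ^ card A * of_bool (B \<subseteq> A)) = (0::int)"
proof -
  obtain i where i: "i \<in> I" "i \<notin> B"
    using assms by (meson card_mono linorder_not_le subsetI)
  define K where "K = I - {i}"
  have I: "I = insert i K" "i \<notin> K" "finite K"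
    using i assms by (auto simp: K_def)
  have inj: "inj_on (insert i) (Pow K)"
    using I by (auto simp: inj_on_def)
  have "(\<Sum>A\<in>insert i ` Pow K. (-1) ^ card A * of_bool (B \<subseteq> A)) =
      (\<Sum>A\<in>Pow K. (-1) ^ card (insert i A) * of_bool (B \<subseteq> insert i A) :: int)"
    using sum.reindex[OF inj] by (simp add: o_def)
  also have "\<dots> = (\<Sum>A\<in>Pow K. - ((-1) ^ card A * of_bool (B \<subseteq> A)))"
  proof (rule sum.cong)
    fix A assume "A \<in> Pow K"
    then have "finite A" "i \<notin> A" using I finite_subset by auto
    then show "(-1) ^ card (insert i A) * of_bool (B \<subseteq> insert i A) =
      - ((-1) ^ card A * of_bool (B \<subseteq> A) :: int)"
      using i by (auto simp: subset_insert)
  qed simp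
  finally have "(\<Sum>A\<in>insert i ` Pow K. (-1) ^ card A * of_bool (B \<subseteq> A)) =
      - (\<Sum>A\<in>Pow K. (-1) ^ card A * of_bool (B \<subseteq> A) :: int)"
    by (simp add: sum_negf)
  moreover have "Pow K \<inter> insert i ` Pow K = {}"
    using I by auto
  ultimately show ?thesis
    using I by (simp add: Pow_insert sum.union_disjoint del: sum_mult_of_bool_eq)
qed

lemma alternating_sum_setpoly:
  assumes "setpoly m F" "finite I" "m < card I"
  shows "(\<Sum>A\<in>Pow I. (-1) ^ card A * F A) = 0"
  using assms(1)
proof (induction rule: setpoly.induct)
  case (add F B c)
  have "(\<Sum>A\<in>Pow I. (-1) ^ card A * (F A + c * of_bool (B \<subseteq> A))) =
      (\<Sum>A\<in>Pow I. (-1) ^ card A * F A) + c * (\<Sum>A\<in>Pow I. (-1) ^ card A * of_bool (B \<subseteq> A))"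
    by (simp add: sum.distrib sum_distrib_left algebra_simps)
  then show ?case using add alternating_sum_monom[of I B] assms by simp
qed simp

text \<open>The elementary symmetric polynomial of degree \<open>k\<close> in the membership
  variables of \<open>I\<close>; it turns \<open>card A choose k\<close> into a polynomial
  weight.\<close>

definition subset_count :: "nat \<Rightarrow> 'i set \<Rightarrow> 'i set \<Rightarrow> int" where
  "subset_count k I A = (\<Sum>B | B \<subseteq> I \<and> card B = k. of_bool (B \<subseteq> A))"

lemma setpoly_subset_count: "finite I \<Longrightarrow> setpoly k (subset_count k I)"
  unfolding subset_count_def[abs_def]
  by (intro setpoly_sum setpoly_monom[where c = 1, simplified]) (auto intro: finite_subset)

lemma subset_count_eq:
  assumes "finite I" "A \<subseteq> I" shows "subset_count k I A = int (card A choose k)"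
proof -
  have "subset_count k I A = int (card {B. B \<subseteq> A \<and> card B = k})"
    unfolding subset_count_def using assms
    by (subst sum.mono_neutral_cong_right[where S = "{B. B \<subseteq> A \<and> card B = k}" and h = "\<lambda>_. 1"]) auto
  then show ?thesis
    using n_subsets[of A k] assms finite_subset by auto
qed

text \<open>By Fermat, \<open>\<Prod>j\<in>J. 1 - (\<Sum>i\<in>A. x i j) ^ (p - 1)\<close> is the indicator modulo \<open>p\<close> of \<open>A\<close> having
  sum zero.\<close>

lemma zero_sum_alternating:
  assumes p: "prime p" and fin: "finite I" "finite J" and h: "setpoly e h"
    and big: "card J * (p - 1) + e < card I"
  shows "int p dvd (\<Sum>A | A \<subseteq> I \<and> zero_sum p J x A. (-1) ^ card A * h A)"
proof -
  define L where "L j A = (\<Sum>i\<in>I. x i j * of_bool ({i} \<subseteq> A))" for j A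
  have L: "setpoly 1 (L j)" for j
    unfolding L_def[abs_def] by (intro setpoly_sum setpoly_monom) auto
  have L_eq: "L j A = (\<Sum>i\<in>A. x i j)" if "A \<subseteq> I" for j A
    unfolding L_def using that fin
    by (intro sum.mono_neutral_cong_right) auto
  define G where "G A = (\<Prod>j\<in>J. 1 + (-1) * L j A ^ (p - 1))" for A
  have "setpoly (card J * (p - 1)) G"
    unfolding G_def[abs_def]
    by (intro setpoly_prod setpoly_plus setpoly_const fin
          setpoly_mult[of 0 "\<lambda>_. -1" "p - 1", simplified add_0] )
       (use setpoly_power[OF L] in auto)
  then have "setpoly (card J * (p - 1) + e) (\<lambda>A. G A * h A)"
    using h by (rule setpoly_mult)
  then have 0: "(\<Sum>A\<in>Pow I. (-1) ^ card A * (G A * h A)) = 0"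
    by (rule alternating_sum_setpoly) (use fin big in auto)
  have G1: "[G A = of_bool (zero_sum p J x A)] (mod int p)" if A: "A \<subseteq> I" for A
  proof (cases "zero_sum p J x A")
    case True
    have "[1 + (-1) * L j A ^ (p - 1) = 1] (mod int p)" if "j \<in> J" for j
    proof -
      have "int p dvd L j A"
        using True that A by (simp add: L_eq zero_sum_def)
      moreover have "p - 1 > 0"
        using prime_gt_1_nat[OF p] by simp
      ultimately have "int p dvd L j A ^ (p - 1)"
        by (meson dvd_power_le dvd_trans dvd_power)
      then show ?thesis
        by (simp add: cong_iff_dvd_diff)
    qed
    then have "[G A = (\<Prod>j\<in>J. 1)] (mod int p)"
      unfolding G_def by (intro cong_prod) auto
    then show ?thesis using True by simp
  next
    case False
    then obtain j where j: "j \<in> J" "\<not> int p dvd L j A"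
      using A by (auto simp: L_eq zero_sum_def)
    have "[L j A ^ (p - 1) = 1] (mod int p)"
    proof -
      have "\<not> p dvd nat (L j A mod int p)"
        using j(2) prime_gt_0_nat[OF p] by (simp add: int_dvd_int_iff[symmetric] dvd_mod_iff)
      then have "[int (nat (L j A mod int p) ^ (p - 1)) = int 1] (mod int p)"
        using fermat_theorem[OF p] cong_int_iff by blast
      then show ?thesis
        using prime_gt_0_nat[OF p] by (simp add: cong_def power_mod)
    qed
    then have "int p dvd 1 + (-1) * L j A ^ (p - 1)"
      by (simp add: cong_iff_dvd_diff dvd_diff_commute)
    then have "int p dvd G A"
      unfolding G_def using j fin by (meson dvd_prodI dvd_trans)
    then show ?thesis using False by (simp add: cong_0_iff)
  qed
  have "[(\<Sum>A\<in>Pow I. (-1) ^ card A * (G A * h A)) =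
      (\<Sum>A\<in>Pow I. (-1) ^ card A * (of_bool (zero_sum p J x A) * h A))] (mod int p)"
    by (intro cong_sum cong_mult cong_refl G1) auto
  also have "(\<Sum>A\<in>Pow I. (-1) ^ card A * (of_bool (zero_sum p J x A) * h A)) =
      (\<Sum>A | A \<subseteq> I \<and> zero_sum p J x A. (-1) ^ card A * h A)"
    using fin by (intro sum.mono_neutral_cong_right) auto
  finally show ?thesis
    using 0 cong_0_iff cong_sym_eq by metis
qed

text \<open>If only the empty set were zero-sum, the alternating sum with weight 1 would equal 1,
  which \<open>p\<close> does not divide.\<close>

lemma davenport:
  assumes p: "prime p" and fin: "finite I" "finite J" and big: "card J * (p - 1) < card I"
  obtains A where "A \<subseteq> I" "A \<noteq> {}" "zero_sum p J x A"
proof (rule ccontr)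
  assume "\<not> thesis"
  then have "{A. A \<subseteq> I \<and> zero_sum p J x A} = {{}}"
    using that by (auto simp: zero_sum_def)
  then show False
    using zero_sum_alternating[OF p fin setpoly_const[of 0 1], of x] big prime_gt_1_nat[OF p] by simp
qed

lemma zero_sum_diff:
  assumes "zero_sum p J x A" "zero_sum p J x B" "B \<subseteq> A" "finite A"
  shows "zero_sum p J x (A - B)"
  using assms by (auto simp: zero_sum_def sum_diff)

text \<open>Vandermonde splits off \<open>p\<close> elements, and the terms with
  \<open>0 < j < p\<close> have a factor divisible by \<open>p\<close>. Hence for
  \<open>card A = k * p\<close> the residue of \<open>k\<close> is given by a polynomial of degree
  \<open>p\<close>.\<close>

lemma binomial_multiple_prime:
  assumes "prime p" shows "[(k * p) choose p = k] (mod p)"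
proof (induction k)
  case 0
  then show ?case using prime_gt_0_nat[OF assms] by (simp add: binomial_eq_0)
next
  case (Suc k)
  have p0: "p > 0" using assms prime_gt_0_nat by blast
  have "(Suc k * p) choose p = (\<Sum>j\<le>p. (k * p choose j) * (p choose (p - j)))"
    using vandermonde[of "k * p" p p] by (simp add: add.commute)
  also have "[\<dots> = (\<Sum>j\<le>p. if j = 0 then 1 else if j = p then k * p choose p else 0)] (mod p)"
  proof (intro cong_sum)
    fix j assume "j \<in> {..p}"
    then show "[(k * p choose j) * (p choose (p - j)) =
        (if j = 0 then 1 else if j = p then k * p choose p else 0)] (mod p)"
      using dvd_choose_prime[of "p - j" p] assms p0 by (auto simp: cong_0_iff intro!: dvd_mult)
  qed
  also have "(\<Sum>j\<le>p. if j = 0 then 1 else if j = p then k * p choose p else 0) = 1 + (k * p choose p)"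
    using p0 by (simp add: sum.remove[of "{..p}" 0] sum.remove[of "{..p} - {0}" p])
  also have "[\<dots> = Suc k] (mod p)"
    using Suc cong_add[OF cong_refl[of 1]] by fastforce
  finally show ?case .
qed

subsection \<open>Dimensions three and four\<close>

text \<open>The added coordinate is constantly 1, so its sum over \<open>A\<close> is
  \<open>card A\<close>, and zero sum there means that \<open>p\<close> divides the length.\<close>

definition with_one :: "('i \<Rightarrow> 'j \<Rightarrow> int) \<Rightarrow> 'i \<Rightarrow> 'j option \<Rightarrow> int" where
  "with_one x i = case_option 1 (x i)"

lemma zero_sum_with_one:
  "zero_sum p (insert None (Some ` J)) (with_one x) A \<longleftrightarrow> p dvd card A \<and> zero_sum p J x A"
  by (auto simp: zero_sum_def with_one_def)

lemma card_insert_None: "finite J \<Longrightarrow> card (insert None (Some ` J)) = card J + 1"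
  by (simp add: card_insert_if card_image)

lemma zero_sum_alternating_multiple:
  assumes "prime p" "finite I" "finite J" "setpoly e h" "(card J + 1) * (p - 1) + e < card I"
  shows "int p dvd (\<Sum>A | A \<subseteq> I \<and> p dvd card A \<and> zero_sum p J x A. (-1) ^ card A * h A)"
  using zero_sum_alternating[of p I "insert None (Some ` J)" e h "with_one x"] assms
  by (simp only: zero_sum_with_one card_insert_None finite_insert finite_imageI)

lemma davenport_multiple:
  assumes "prime p" "finite I" "finite J" "(card J + 1) * (p - 1) < card I"
  obtains A where "A \<subseteq> I" "A \<noteq> {}" "p dvd card A" "zero_sum p J x A"
  using davenport[of p I "insert None (Some ` J)" "with_one x"] assms
  by (auto simp only: zero_sum_with_one card_insert_None finite_insert finite_imageI)

text \<open>With one element of \<open>A\<close> left out, enough remain for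
  \<open>davenport\<close>. The zero-sum part found is proper, so either it or its nonempty
  complement is at most half of \<open>A\<close>.\<close>

lemma zero_sum_split:
  assumes p: "prime p" and J: "finite J" and A: "finite A" "zero_sum p J x A"
    and big: "card J * (p - 1) + 1 < card A"
  obtains B where "B \<subseteq> A" "B \<noteq> {}" "zero_sum p J x B" "2 * card B \<le> card A"
proof -
  obtain a where a: "a \<in> A" using big by fastforce
  have "card J * (p - 1) < card (A - {a})" using A a big by simp
  then obtain B where B: "B \<subseteq> A - {a}" "B \<noteq> {}" "zero_sum p J x B"
    using davenport[OF p _ J, of "A - {a}" x] A by auto
  then have BA: "B \<subseteq> A" by auto
  have "card (A - B) + card B = card A"
    using A BA by (metis card_Diff_subset card_mono finite_subset le_add_diff_inverse2)
  then consider "2 * card B \<le> card A" | "2 * card (A - B) \<le> card A" by linarith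
  then show thesis
  proof cases
    case 2
    have "zero_sum p J x (A - B)" using zero_sum_diff[OF A(2) B(3) BA A(1)] .
    moreover have "A - B \<noteq> {}" using a B by auto
    ultimately show thesis using 2 that[of "A - B"] by blast
  qed (use that BA B in blast)
qed

text \<open>With the constant coordinate added, leaving out one element gives a proper part whose
  length is a multiple of \<open>p\<close>. Complements pair \<open>p\<close> with
  \<open>4 * p\<close> and \<open>2 * p\<close> with \<open>3 * p\<close>.\<close>

lemma zero_sum_card_5p:
  assumes p: "prime p" and J: "finite J" and A: "finite A" "zero_sum p J x A" "card A = 5 * p"
    and big: "(card J + 1) * (p - 1) + 1 < 5 * p"
  obtains B where "B \<subseteq> A" "zero_sum p J x B" "card B = p \<or> card B = 2 * p"
proof -
  have p0: "p > 0" using p prime_gt_0_nat by blast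
  obtain a where a: "a \<in> A" using A p0 by fastforce
  have "(card J + 1) * (p - 1) < card (A - {a})" using A a big by simp
  then obtain B where B: "B \<subseteq> A - {a}" "B \<noteq> {}" "p dvd card B" "zero_sum p J x B"
    using davenport_multiple[OF p _ J, of "A - {a}" x] A by auto
  then obtain k where k: "card B = p * k" by (auto elim: dvdE)
  have BA: "B \<subseteq> A" "B \<subset> A" using B a by auto
  then have "card B < card A" "card B > 0"
    using A(1) B(2) by (simp_all only: psubset_card_mono card_gt_0_iff finite_subset) auto
  then have "p * k < p * 5" "p * k > 0"
    using A k by auto
  then have "k \<in> {1, 2, 3, 4}" by auto
  moreover have "card (A - B) = 5 * p - p * k"
    using A BA k by (simp add: card_Diff_subset finite_subset)
  moreover have "zero_sum p J x (A - B)" using zero_sum_diff[OF A(2) B(4) BA(1) A(1)] .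
  ultimately show thesis
    using that[of B] that[of "A - B"] BA B k by auto
qed

text \<open>Nonempty sets contribute 0 modulo \<open>p\<close> to the alternating sum, which leaves
  the weight of the empty set. The weight \<open>h\<close> will be chosen to vanish at all lengths
  not yet excluded.\<close>

lemma dvd_weight_empty:
  assumes p: "prime p" and fin: "finite I" "finite J" and h: "setpoly e h"
    and big: "(card J + 1) * (p - 1) + e < card I"
    and van: "\<And>A. A \<subseteq> I \<Longrightarrow> A \<noteq> {} \<Longrightarrow> p dvd card A \<Longrightarrow> zero_sum p J x A \<Longrightarrow> int p dvd h A"
  shows "int p dvd h {}"
proof -
  let ?Z = "{A. A \<subseteq> I \<and> p dvd card A \<and> zero_sum p J x A}"
  have "finite ?Z" using fin by auto
  moreover have "{} \<in> ?Z" by (simp add: zero_sum_def)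
  ultimately have "(\<Sum>A\<in>?Z. (-1) ^ card A * h A) = h {} + (\<Sum>A\<in>?Z - {{}}. (-1) ^ card A * h A)"
    by (simp add: sum.remove[of ?Z "{}"])
  moreover have "int p dvd (\<Sum>A\<in>?Z - {{}}. (-1) ^ card A * h A)"
    using van by (intro dvd_sum) auto
  ultimately show ?thesis
    using zero_sum_alternating_multiple[OF p fin h big, of x] by (simp add: dvd_add_left_iff)
qed

lemma subset_count_multiple:
  assumes "prime p" "finite I" "A \<subseteq> I" "card A = k * p"
  shows "int p dvd subset_count p I A - int k"
  using binomial_multiple_prime[OF assms(1), of k] assms
  by (simp add: subset_count_eq cong_int_iff[symmetric] cong_iff_dvd_diff)

lemma zero_sum_dim3:
  assumes p: "prime p" "p \<noteq> 2" and J: "finite J" "card J = 3" and I: "card I = 6 * p - 3"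
  obtains A where "A \<subseteq> I" "A \<noteq> {}" "zero_sum p J x A" "2 * card A \<le> 3 * p - 1"
proof (rule ccontr)
  note found = that
  assume "\<not> thesis"
  then have no: "\<not> 2 * card A \<le> 3 * p - 1" if "A \<subseteq> I" "A \<noteq> {}" "zero_sum p J x A" for A
    using that found[of A] \<open>\<not> thesis\<close> by blast
  have p3: "p \<ge> 3" and odd: "odd p"
    using p prime_ge_2_nat[of p] prime_odd_nat[of p] by auto
  have fin: "finite I" using I p3 by (intro card_ge_0_finite) auto
  have no1: "card A \<noteq> p" if "A \<subseteq> I" "zero_sum p J x A" for A
    using no[of A] that p3 by fastforce
  have no3: "card A \<noteq> 3 * p" if A: "A \<subseteq> I" "zero_sum p J x A" for A
  proof
    assume c: "card A = 3 * p"
    obtain B where B: "B \<subseteq> A" "B \<noteq> {}" "zero_sum p J x B" "2 * card B \<le> card A"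
    proof (rule zero_sum_split[OF p(1) J(1) _ A(2)])
      show "finite A" "card J * (p - 1) + 1 < card A"
        using J c p3 A fin finite_subset[of A I] by auto
    qed
    \<comment> \<open>Oddness improves \<open>2 * card B \<le> 3 * p\<close> to the required
      \<open>2 * card B \<le> 3 * p - 1\<close>.\<close>
    have "odd (3 * p)" using odd by simp
    then have "2 * card B \<noteq> 3 * p" by (metis dvd_triv_left)
    moreover have "B \<subseteq> I" using B A by blast
    ultimately show False using no[of B] B c by linarith
  qed
  have no5: "card A \<noteq> 5 * p" if A: "A \<subseteq> I" "zero_sum p J x A" for A
  proof
    assume c: "card A = 5 * p"
    have finA: "finite A" using fin A finite_subset by blast
    obtain B where B: "B \<subseteq> A" "zero_sum p J x B" "card B = p \<or> card B = 2 * p"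
    proof (rule zero_sum_card_5p[OF p(1) J(1) finA A(2) c])
      show "(card J + 1) * (p - 1) + 1 < 5 * p" using J p3 by simp
    qed
    then have "card (A - B) = 3 * p" if "card B = 2 * p"
      using that finA c by (simp add: card_Diff_subset finite_subset)
    moreover have "zero_sum p J x (A - B)" using zero_sum_diff[OF A(2) B(2) B(1) finA] .
    ultimately show False
      using no1[of B] no3[of "A - B"] B A by blast
  qed
  \<comment> \<open>At \<open>card A = k * p\<close> this is \<open>(k - 2) * (k - 4)\<close> modulo
    \<open>p\<close>; only \<open>k = 2\<close> and \<open>k = 4\<close> are left.\<close>
  define h where "h A = (subset_count p I A + (- 2)) * (subset_count p I A + (- 4))" for A
  have h: "setpoly (p + p) h"
    unfolding h_def[abs_def]
    by (intro setpoly_mult setpoly_plus setpoly_const setpoly_subset_count fin)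
  have "int p dvd h {}"
  proof (rule dvd_weight_empty[OF p(1) fin J(1) h])
    \<comment> \<open>The left side is \<open>4 * (p - 1) + 2 * p = 6 * p - 4\<close>, one less than
      the number of terms.\<close>
    show "(card J + 1) * (p - 1) + (p + p) < card I"
      using J I p3 by simp
  next
    fix A assume A: "A \<subseteq> I" "A \<noteq> {}" "p dvd card A" "zero_sum p J x A"
    then obtain k where k: "card A = k * p" by (metis dvd_def mult.commute)
    have "k * p < 6 * p" using k card_mono[OF fin A(1)] I p3 by linarith
    moreover have "k \<noteq> 0" using k A fin finite_subset[of A I] by auto
    ultimately have "k \<in> {1, 2, 3, 4, 5}" by auto
    then have "k = 2 \<or> k = 4" using no1[of A] no3[of A] no5[of A] A k by auto
    then show "int p dvd h A"
      using subset_count_multiple[OF p(1) fin A(1) k] unfolding h_def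
      by (auto simp del: mult_minus_right)
  qed
  \<comment> \<open>The value at \<open>k = 0\<close> is a power of 2, whereas \<open>p\<close> is
    odd.\<close>
  moreover have "h {} = 8"
    using p3 by (simp add: h_def subset_count_eq fin binomial_eq_0)
  ultimately have "p dvd 2 ^ 3" by (simp add: int_dvd_int_iff[symmetric])
  then show False
    using p by (meson prime_dvd_power primes_dvd_imp_eq two_is_prime_nat)
qed

lemma zero_sum_dim4:
  assumes p: "prime p" "p \<noteq> 3" and J: "finite J" "card J = 4" and I: "card I = 6 * p - 3"
  obtains A where "A \<subseteq> I" "A \<noteq> {}" "zero_sum p J x A" "card A \<le> 2 * p"
proof (rule ccontr)
  note found = that
  assume "\<not> thesis"
  then have no: "\<not> card A \<le> 2 * p" if "A \<subseteq> I" "A \<noteq> {}" "zero_sum p J x A" for A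
    using that found[of A] \<open>\<not> thesis\<close> by blast
  have p2: "p \<ge> 2" using p prime_ge_2_nat by blast
  have fin: "finite I" using I p2 by (intro card_ge_0_finite) auto
  have no12: "card A \<noteq> p \<and> card A \<noteq> 2 * p" if "A \<subseteq> I" "zero_sum p J x A" for A
    using no[of A] that p2 by fastforce
  have no4: "card A \<noteq> 4 * p" if A: "A \<subseteq> I" "zero_sum p J x A" for A
  proof
    assume c: "card A = 4 * p"
    obtain B where B: "B \<subseteq> A" "B \<noteq> {}" "zero_sum p J x B" "2 * card B \<le> card A"
    proof (rule zero_sum_split[OF p(1) J(1) _ A(2)])
      show "finite A" "card J * (p - 1) + 1 < card A"
        using J c p2 A fin finite_subset[of A I] by auto
    qed
    then show False using no[of B] A c by auto
  qed
  have no5: "card A \<noteq> 5 * p" if A: "A \<subseteq> I" "zero_sum p J x A" for A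
  proof
    assume c: "card A = 5 * p"
    have finA: "finite A" using fin A finite_subset by blast
    obtain B where B: "B \<subseteq> A" "zero_sum p J x B" "card B = p \<or> card B = 2 * p"
    proof (rule zero_sum_card_5p[OF p(1) J(1) finA A(2) c])
      show "(card J + 1) * (p - 1) + 1 < 5 * p" using J p2 by simp
    qed
    then show False using no12[of B] A by blast
  qed
  \<comment> \<open>Only length \<open>3 * p\<close> is left, so a weight linear in \<open>k\<close>
    suffices; the total degree is \<open>5 * (p - 1) + p = 6 * p - 5\<close>.\<close>
  define h where "h A = subset_count p I A + (- 3)" for A
  have h: "setpoly p h"
    unfolding h_def[abs_def] by (intro setpoly_plus setpoly_const setpoly_subset_count fin)
  have "int p dvd h {}"
  proof (rule dvd_weight_empty[OF p(1) fin J(1) h])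
    show "(card J + 1) * (p - 1) + p < card I"
      using J I p2 by simp
  next
    fix A assume A: "A \<subseteq> I" "A \<noteq> {}" "p dvd card A" "zero_sum p J x A"
    then obtain k where k: "card A = k * p" by (metis dvd_def mult.commute)
    have "k * p < 6 * p" using k card_mono[OF fin A(1)] I p2 by linarith
    moreover have "k \<noteq> 0" using k A fin finite_subset[of A I] by auto
    ultimately have "k \<in> {1, 2, 3, 4, 5}" by auto
    then have "k = 3" using no12[of A] no4[of A] no5[of A] A k by auto
    then show "int p dvd h A"
      using subset_count_multiple[OF p(1) fin A(1) k] unfolding h_def by simp
  qed
  moreover have "h {} = - 3"
    using p2 by (simp add: h_def subset_count_eq fin binomial_eq_0)
  ultimately have "p dvd 3" by (simp add: int_dvd_int_iff[symmetric])
  moreover from this have "p = 2"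
    using p p2 dvd_imp_le[of p 3] by simp
  ultimately show False by simp
qed

subsection \<open>Fifteen elements of a group of order 81 and exponent 3\<close>

definition subgrp :: "'v::ab_group_add set \<Rightarrow> bool" where
  "subgrp H \<longleftrightarrow> 0 \<in> H \<and> (\<forall>x\<in>H. \<forall>y\<in>H. x - y \<in> H)"

lemma subgrp_zero: "subgrp H \<Longrightarrow> 0 \<in> H"
  and subgrp_diff: "subgrp H \<Longrightarrow> x \<in> H \<Longrightarrow> y \<in> H \<Longrightarrow> x - y \<in> H"
  by (auto simp: subgrp_def)

lemma subgrp_uminus: "subgrp H \<Longrightarrow> x \<in> H \<Longrightarrow> - x \<in> H"
  using subgrp_diff[of H 0 x] subgrp_zero[of H] by simp

lemma subgrp_plus: "subgrp H \<Longrightarrow> x \<in> H \<Longrightarrow> y \<in> H \<Longrightarrow> x + y \<in> H"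
  using subgrp_diff[of H x "- y"] subgrp_uminus[of H y] by simp

lemma subgrp_uminus_iff: "subgrp H \<Longrightarrow> - x \<in> H \<longleftrightarrow> x \<in> H"
  using subgrp_uminus[of H x] subgrp_uminus[of H "- x"] by auto

lemma subgrp_plus_left: "subgrp H \<Longrightarrow> x \<in> H \<Longrightarrow> x + y \<in> H \<longleftrightarrow> y \<in> H"
  using subgrp_plus[of H x y] subgrp_diff[of H "x + y" x] by auto

text \<open>In exponent 3 this is the subgroup generated by \<open>H\<close> and \<open>u\<close>:
  the union of the cosets of 0, \<open>u\<close> and \<open>- u\<close>.\<close>

definition adjoin :: "'v::ab_group_add set \<Rightarrow> 'v \<Rightarrow> 'v set" where
  "adjoin H u = {v. v \<in> H \<or> v - u \<in> H \<or> v + u \<in> H}"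

text \<open>The counterexample to be refuted for \<open>p = 3\<close> in dimension four: fifteen
  indexed terms without a zero sum of length at most six.\<close>

locale short_free =
  fixes s :: "'i \<Rightarrow> 'v::{ab_group_add,finite}" and I :: "'i set"
  assumes triple: "x + x + x = (0::'v)"
    and card_group: "card (UNIV :: 'v set) = 81"
    and card_I: "card I = 15"
    and free: "A \<subseteq> I \<Longrightarrow> A \<noteq> {} \<Longrightarrow> card A \<le> 6 \<Longrightarrow> sum s A \<noteq> 0"
begin

lemma finite_I: "finite I"
  using card_I by (intro card_ge_0_finite) auto

lemma double: "x + x = - (x::'v)"
  using triple[of x] by (simp add: eq_neg_iff_add_eq_0)

lemma adjoin_subgrp:
  assumes H: "subgrp H" shows "subgrp (adjoin H (u::'v))"
proof -
  have "x - y \<in> H \<or> x - y - u \<in> H \<or> x - y + u \<in> H"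
    if x: "x \<in> H \<or> x - u \<in> H \<or> x + u \<in> H" and y: "y \<in> H \<or> y - u \<in> H \<or> y + u \<in> H" for x y
  proof -
    have e: "x - u - (y + u) = x - y + u" "x + u - (y - u) = x - y - u"
      using triple[of u] by (simp_all add: algebra_simps eq_diff_eq)
    have e': "x - (y - u) = x - y + u" "x - (y + u) = x - y - u" "x - u - y = x - y - u"
      "x - u - (y - u) = x - y" "x + u - y = x - y + u" "x + u - (y + u) = x - y"
      by (simp_all add: algebra_simps)
    show ?thesis
      using x y subgrp_diff[OF H] e e' by metis
  qed
  then show ?thesis
    using H by (auto simp: subgrp_def adjoin_def)
qed

lemma subset_adjoin: "H \<subseteq> adjoin H u"
  by (auto simp: adjoin_def)

text \<open>The three cosets are disjoint; an element common to those of \<open>u\<close> and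
  \<open>- u\<close> would put \<open>- (u + u) = u\<close> into \<open>H\<close>.\<close>

lemma card_adjoin:
  assumes H: "subgrp H" and u: "(u::'v) \<notin> H" shows "card (adjoin H u) = 3 * card H"
proof -
  have eq: "adjoin H u = H \<union> ((\<lambda>h. h + u) ` H \<union> (\<lambda>h. h - u) ` H)"
    by (force simp: adjoin_def image_iff algebra_simps)
  have disj: "H \<inter> ((\<lambda>h. h + u) ` H \<union> (\<lambda>h. h - u) ` H) = {}"
    using u subgrp_plus_left[OF H] subgrp_uminus_iff[OF H] by (auto simp: diff_conv_add_uminus simp del: add_uminus_conv_diff)
  have "(\<lambda>h. h + u) ` H \<inter> (\<lambda>h. h - u) ` H = {}"
  proof -
    have "h - h' = u" if "h + u = h' - u" for h h'
    proof -
      have "h - h' = - (u + u)" using that by (simp add: algebra_simps)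
      then show ?thesis using double[of u] by simp
    qed
    then show ?thesis using u subgrp_diff[OF H] by blast
  qed
  moreover have "card ((\<lambda>h. h + u) ` H) = card H" "card ((\<lambda>h. h - u) ` H) = card H"
    by (auto intro!: card_image inj_onI)
  ultimately show ?thesis
    using disj by (simp add: eq card_Un_disjoint)
qed

text \<open>Adjoining \<open>u\<close> and then \<open>w\<close> to \<open>P\<close> gives
  \<open>9 * 3 * 3 = 81\<close> elements, the whole group. Up to sign the nonzero classes modulo
  \<open>P\<close> are those of \<open>u\<close>, \<open>w\<close>, \<open>u + w\<close>,
  \<open>u - w\<close>.\<close>

lemma four_lines:
  assumes P: "subgrp P" "card P = 9"
    and u: "u \<notin> P" and w: "w \<notin> adjoin P (u::'v)"
  shows "r \<in> P \<or> (\<exists>v\<in>{u, w, u + w, u - w}. r - v \<in> P \<or> r + v \<in> P)"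
proof -
  have "card (adjoin (adjoin P u) w) = card (UNIV::'v set)"
    using card_group P u w by (simp add: card_adjoin adjoin_subgrp)
  then have "adjoin (adjoin P u) w = UNIV"
    by (intro card_subset_eq) auto
  then have "r \<in> adjoin (adjoin P u) w" by simp
  then show ?thesis
    by (auto simp: adjoin_def algebra_simps)
qed

section \<open>Consequences of having no short zero sum\<close>

lemma free_not_neg:
  assumes "T \<subseteq> I" "A \<subseteq> I" "A \<noteq> {}" "T \<inter> A = {}" "sum s T = - sum s A"
  shows "6 < card T + card A"
proof (rule ccontr)
  assume "\<not> 6 < card T + card A"
  moreover have "finite T" "finite A" using assms(1,2) finite_I by (auto intro: finite_subset)
  ultimately have "card (T \<union> A) \<le> 6" "sum s (T \<union> A) = 0"
    using assms by (simp_all add: card_Un_disjoint sum.union_disjoint)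
  then show False using free[of "T \<union> A"] assms by blast
qed

lemma free_single: "i \<in> I \<Longrightarrow> s i \<noteq> 0"
  using free[of "{i}"] by simp

lemma free_pair: "i \<in> I \<Longrightarrow> j \<in> I \<Longrightarrow> i \<noteq> j \<Longrightarrow> s i + s j \<noteq> 0"
  using free[of "{i, j}"] by simp

lemma free_triple:
  "i \<in> I \<Longrightarrow> j \<in> I \<Longrightarrow> k \<in> I \<Longrightarrow> i \<noteq> j \<Longrightarrow> i \<noteq> k \<Longrightarrow> j \<noteq> k \<Longrightarrow> s i + s j + s k \<noteq> 0"
  using free[of "{i, j, k}"] by (simp add: add.assoc)

lemma three_equal:
  assumes "A \<subseteq> I" "card A = 3" "\<And>r. r \<in> A \<Longrightarrow> s r = c"
  shows False
proof -
  have "sum s A = (\<Sum>r\<in>A. c)" using assms by (intro sum.cong) auto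
  also have "\<dots> = c + c + c"
    using assms(2) by (auto simp: card_3_iff add.assoc)
  finally show False using assms free[of A] triple by force
qed

text \<open>The fibre of \<open>R\<close> over the class of \<open>v\<close> in the quotient by
  \<open>P\<close>.\<close>

definition cls :: "'v set \<Rightarrow> 'i set \<Rightarrow> 'v \<Rightarrow> 'i set" where
  "cls P R v = {r \<in> R. s r - v \<in> P}"

lemma finite_cls: "R \<subseteq> I \<Longrightarrow> finite (cls P R v)"
  by (rule finite_subset[OF _ finite_I]) (auto simp: cls_def)

lemma cls_disjoint:
  assumes "subgrp P" "v - w \<notin> P" "r \<in> cls P R v" "t \<in> cls P R w"
  shows "r \<noteq> t"
proof
  assume "r = t"
  then have "s r - w \<in> P" "s r - v \<in> P" using assms by (auto simp: cls_def)
  then have "(s r - w) - (s r - v) \<in> P" by (rule subgrp_diff[OF assms(1)])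
  then show False using assms by simp
qed

lemma not_double:
  assumes "subgrp P" "(v::'v) \<notin> P" shows "v + v \<notin> P"
  using assms double[of v] subgrp_uminus_iff[of P v] by simp

text \<open>Modulo \<open>P\<close> the sum is \<open>v + v + v\<close>, which vanishes in exponent
  3.\<close>

lemma cls_three_sum:
  assumes P: "subgrp P" and A: "A \<subseteq> cls P R v" "card A = 3"
  shows "sum s A \<in> P"
proof -
  obtain x y z where xyz: "A = {x, y, z}" "x \<noteq> y" "x \<noteq> z" "y \<noteq> z"
    using A by (auto simp: card_3_iff)
  have "(s x - v) + ((s y - v) + (s z - v)) \<in> P"
    using A xyz by (intro subgrp_plus[OF P]) (auto simp: cls_def)
  moreover have "(s x - v) + ((s y - v) + (s z - v)) = sum s A - (v + v + v)"
    using xyz by (simp add: algebra_simps)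
  ultimately show ?thesis by (simp add: triple)
qed

lemma cls_sum:
  assumes P: "subgrp P" and "v1 + v2 + v3 \<in> P"
    and "x \<in> cls P R v1" "y \<in> cls P R v2" "z \<in> cls P R v3"
  shows "s x + s y + s z \<in> P"
proof -
  have "(s x - v1) + ((s y - v2) + (s z - v3)) \<in> P"
    using assms(3-) by (intro subgrp_plus[OF P]) (simp_all add: cls_def)
  from subgrp_plus[OF P this assms(2)] show ?thesis by (simp add: algebra_simps)
qed

text \<open>The quotient by \<open>P\<close> is a plane with four lines through the origin. However one generator is chosen
  on each of them, three of the chosen ones sum to zero, so the sign of each can be chosen by majority.\<close>

lemma heavy_lines:
  assumes P: "subgrp P" "card P = 9" and R: "R \<subseteq> I" "\<And>r. r \<in> R \<Longrightarrow> s r \<notin> P" "11 \<le> card R"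
    and line: "\<And>v. v \<notin> P \<Longrightarrow> card (cls P R v) + card (cls P R (- v)) \<le> 3"
  obtains v1 v2 v3 where "v1 - v2 \<notin> P" "v1 - v3 \<notin> P" "v2 - v3 \<notin> P" "v1 + v2 + v3 \<in> P"
    "v1 \<notin> P" "v2 \<notin> P" "v3 \<notin> P"
    "\<And>v. v \<in> {v1, v2, v3} \<Longrightarrow> card (cls P R (- v)) \<le> card (cls P R v)"
    "card R \<le> 3 + (\<Sum>v\<leftarrow>[v1, v2, v3]. card (cls P R v) + card (cls P R (- v)))"
proof -
  define N where "N v = card (cls P R v) + card (cls P R (- v))" for v
  have neg: "- v \<in> P \<longleftrightarrow> v \<in> P" for v using subgrp_uminus_iff P by blast
  have sign: "\<exists>u\<in>{v, - v}. card (cls P R (- u)) \<le> card (cls P R u)" for v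
    by (auto simp: le_cases)
  obtain r1 where r1: "r1 \<in> R" using R by fastforce
  obtain u where u: "u \<in> {s r1, - s r1}" "card (cls P R (- u)) \<le> card (cls P R u)"
    using sign by blast
  have uP: "u \<notin> P" using u r1 R neg by auto
  \<comment> \<open>One line carries at most three indices, so a term off the line of
    \<open>u\<close> provides a second generator \<open>w\<close>.\<close>
  have "\<not> R \<subseteq> cls P R u \<union> cls P R (- u)"
  proof
    assume "R \<subseteq> cls P R u \<union> cls P R (- u)"
    then have "card R \<le> card (cls P R u \<union> cls P R (- u))"
      using finite_cls[OF R(1)] by (intro card_mono) auto
    then show False
      using card_Un_le[of "cls P R u" "cls P R (- u)"] line[OF uP] R by linarith
  qed
  then obtain r2 where r2: "r2 \<in> R" "s r2 \<notin> adjoin P u"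
    using R by (auto simp: cls_def adjoin_def)
  obtain w where w: "w \<in> {s r2, - s r2}" "card (cls P R (- w)) \<le> card (cls P R w)"
    using sign by blast
  have wP: "w \<notin> adjoin P u"
    using w r2 subgrp_uminus_iff[OF adjoin_subgrp[OF P(1)]] by auto
  then have wP': "w \<notin> P" "w - u \<notin> P" "w + u \<notin> P" "u - w \<notin> P" "u + w \<notin> P"
    using neg[of "w - u"] by (auto simp: adjoin_def add.commute)
  have "R \<subseteq> (\<Union>v\<in>{u, w, u + w, u - w}. cls P R v \<union> cls P R (- v))"
    using four_lines[OF P uP wP] R by (fastforce simp: cls_def)
  then have "card R \<le> card (\<Union>v\<in>{u, w, u + w, u - w}. cls P R v \<union> cls P R (- v))"
    using finite_cls[OF R(1)] by (intro card_mono) auto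
  also have "\<dots> \<le> N u + N w + N (u + w) + N (u - w)"
  proof -
    have "card (A \<union> B \<union> (C \<union> D) \<union> (E \<union> F) \<union> (G \<union> K)) \<le>
        card A + card B + (card C + card D) + (card E + card F) + (card G + card K)"
      for A B C D E F G K :: "'i set"
      by (intro order_trans[OF card_Un_le] add_mono order_refl)
    then show ?thesis unfolding N_def by (simp add: Un_assoc)
  qed
  finally have tot: "card R \<le> N u + N w + N (u + w) + N (u - w)" .
  have N3: "N u \<le> 3" "N w \<le> 3" "N (u + w) \<le> 3" "N (u - w) \<le> 3"
    unfolding N_def using line uP wP' by blast+
  have Nneg: "N (- v) = N v" for v by (simp add: N_def)
  have d: "u + u = - u" "w + w = - w" by (rule double)+
  have dd: "x + (x + y) = y - x" for x y :: 'v
    using double[of x] by (simp add: add.assoc[symmetric])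
  \<comment> \<open>The signs of \<open>u\<close> and \<open>w\<close> are already the majority
    ones. The majority signs on the other two lines decide which relation is used:
    \<open>u + w - (u + w) = 0\<close>, \<open>u + (u + w) + (u - w) = 3 u\<close>, or
    \<open>w + (u + w) + (w - u) = 3 w\<close>. The omitted line carries at most three
    indices.\<close>
  consider "card (cls P R (u + w)) \<le> card (cls P R (- (u + w)))"
    | "card (cls P R (- (u + w))) \<le> card (cls P R (u + w))" "card (cls P R (- (u - w))) \<le> card (cls P R (u - w))"
    | "card (cls P R (- (u + w))) \<le> card (cls P R (u + w))" "card (cls P R (u - w)) \<le> card (cls P R (- (u - w)))"
    by linarith
  then show thesis
  proof cases
    case 1
    define z where "z = - (u + w)"
    have z: "- z = u + w" "z \<notin> P" "card (cls P R (- z)) \<le> card (cls P R z)" "N z = N (u + w)"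
      using 1 wP' by (simp_all only: z_def minus_minus neg Nneg simp_thms)
    have e: "u - z = w - u" "w - z = u - w" "u + w + z = 0"
      using dd[of u w] dd[of w u] by (simp_all add: z_def add.commute)
    show thesis
    proof (rule that[of u w z])
      show "card R \<le> 3 + (\<Sum>v\<leftarrow>[u, w, z]. card (cls P R v) + card (cls P R (- v)))"
        using tot N3 z(4) unfolding N_def by simp
      show "card (cls P R (- v)) \<le> card (cls P R v)" if "v \<in> {u, w, z}" for v
        using that z(3) u(2) w(2) by blast
    qed (simp_all add: e wP' uP z(2) subgrp_zero[OF P(1)])
  next
    case 2
    have "u + w - (u - w) = w + w" "u + (u + w) + (u - w) = u + u + u"
      by (simp_all add: algebra_simps)
    then have e: "u - (u + w) = - w" "u - (u - w) = w" "u + w - (u - w) = - w" "u + (u + w) + (u - w) = 0"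
      by (simp_all only: d triple) simp_all
    show thesis
    proof (rule that[of u "u + w" "u - w"])
      show "card R \<le> 3 + (\<Sum>v\<leftarrow>[u, u + w, u - w]. card (cls P R v) + card (cls P R (- v)))"
        using tot N3 unfolding N_def by simp
      show "card (cls P R (- v)) \<le> card (cls P R v)" if "v \<in> {u, u + w, u - w}" for v
        using that 2 u(2) by blast
    qed (simp_all only: e neg wP' uP subgrp_zero[OF P(1)] simp_thms)
  next
    case 3
    define y where "y = - (u - w)"
    have y: "- y = u - w" "y \<notin> P" "card (cls P R (- y)) \<le> card (cls P R y)" "N y = N (u - w)"
      using 3 wP' by (simp_all only: y_def minus_minus neg Nneg simp_thms)
    have "w - y = u" "u + w - y = u + u" "w + (u + w) + y = w + w + w" "w - (u + w) = - u"
      by (simp_all add: y_def algebra_simps)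
    then have e: "w - (u + w) = - u" "w - y = u" "u + w - y = - u" "w + (u + w) + y = 0"
      by (simp_all only: d triple left_minus)
    have mw: "card (cls P R (- (u + w))) \<le> card (cls P R (u + w))" using 3 by simp
    show thesis
    proof (rule that[of w "u + w" y])
      show "card R \<le> 3 + (\<Sum>v\<leftarrow>[w, u + w, y]. card (cls P R v) + card (cls P R (- v)))"
        using tot N3 y(4) unfolding N_def by simp
      show "card (cls P R (- v)) \<le> card (cls P R v)" if "v \<in> {w, u + w, y}" for v
        using that mw y(3) w(2) by blast
    qed (simp_all only: e neg wP' uP y(2) subgrp_zero[OF P(1)] simp_thms)
  qed
qed

section \<open>Excluding repeated terms\<close>

lemma subgrp_trivial: "subgrp {0::'v}"
  by (simp add: subgrp_def)

lemma line_cases: "v \<in> adjoin {0::'v} a \<longleftrightarrow> v = 0 \<or> v = a \<or> v = - a"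
  by (auto simp: adjoin_def add_eq_0_iff2)

lemma line_subgrp: "subgrp (adjoin {0} (a::'v))"
  by (rule adjoin_subgrp[OF subgrp_trivial])

lemma card_line: "a \<noteq> 0 \<Longrightarrow> card (adjoin {0} (a::'v)) = 3"
  using card_adjoin[OF subgrp_trivial] by simp


text \<open>Let \<open>P\<close> be the plane spanned by \<open>a\<close> and \<open>s k\<close>. The terms with indices in \<open>U\<close> represent all of
  \<open>P\<close>, so a sum of at most three other terms lies in \<open>P\<close> only if it is \<open>- sum s U\<close> with three terms.\<close>

lemma same_line_False:
  assumes i: "i0 \<in> I" "i1 \<in> I" "i0 \<noteq> i1" "s i0 = a" "s i1 = a"
    and kl: "k \<in> I - {i0, i1}" "l \<in> I - {i0, i1}" "k \<noteq> l" "s l - s k \<in> adjoin {0} a"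
  shows False
proof -
  define H where "H = adjoin {0} a"
  define P where "P = adjoin H (s k)"
  define U where "U = {i0, i1, k, l}"
  define R where "R = I - U"
  have a: "a \<noteq> 0" using free_single i by blast
  have H: "subgrp H" "card H = 3" using line_subgrp card_line[OF a] by (auto simp: H_def)
  have "s k \<notin> H"
  proof
    assume "s k \<in> H"
    then consider "s k = 0" | "s k = a" | "s k = - a" by (auto simp: H_def line_cases)
    then show False
    proof cases
      case 1 then show False using free_single kl by blast
    next
      case 2 then show False using free_triple[of i0 i1 k] triple[of a] i kl by auto
    next
      case 3 then show False using free_pair[of i0 k] i kl by auto
    qed
  qed
  then have P: "subgrp P" "card P = 9"
    using H by (simp_all add: P_def adjoin_subgrp card_adjoin)
  have U: "U \<subseteq> I" "card U = 4" using i kl by (auto simp: U_def)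
  \<comment> \<open>Zero, one or two copies of \<open>a\<close> give 0, \<open>a\<close> and
    \<open>a + a = - a\<close>.\<close>
  have H_rep: "\<exists>T\<subseteq>{i0, i1}. sum s T = h" if "h \<in> H" for h
  proof -
    consider "h = 0" | "h = a" | "h = - a" using \<open>h \<in> H\<close> by (auto simp: H_def line_cases)
    then show ?thesis
    proof cases
      case 1 then show ?thesis by (intro exI[of _ "{}"]) auto
    next
      case 2 then show ?thesis using i by (intro exI[of _ "{i0}"]) auto
    next
      case 3 then show ?thesis using i double[of a] by (intro exI[of _ "{i0, i1}"]) auto
    qed
  qed
  have dd: "(x + y) - (z - y) = x - z - y" for x y z :: 'v
  proof -
    have "(x + y) - (z - y) = x - z + (y + y)" by (simp add: algebra_simps)
    then show ?thesis by (simp add: double)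
  qed
  have P_rep: "\<exists>T\<subseteq>U. sum s T = h" if h: "h \<in> P" for h
  proof -
    consider "h \<in> H" | "h - s k \<in> H" | "h + s k \<in> H" using h by (auto simp: P_def adjoin_def)
    then show ?thesis
    proof cases
      case 1 then show ?thesis using H_rep[of h] by (auto simp: U_def)
    next
      case 2
      then obtain T where T: "T \<subseteq> {i0, i1}" "sum s T = h - s k" using H_rep by blast
      then have "sum s (insert k T) = h"
        using kl finite_subset[OF T(1)] by (subst sum.insert) auto
      then show ?thesis using T by (intro exI[of _ "insert k T"]) (auto simp: U_def)
    next
      \<comment> \<open>Modulo \<open>H\<close> the terms at \<open>k\<close> and \<open>l\<close>
        agree, so together they represent \<open>s k + s k = - s k\<close>.\<close>
      case 3
      then have "(h + s k) - (s l - s k) \<in> H" using kl H by (auto simp: H_def intro: subgrp_diff)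
      then obtain T where T: "T \<subseteq> {i0, i1}" "sum s T = (h + s k) - (s l - s k)" using H_rep by blast
      then have "sum s T = h - s l - s k"
        using dd[of h "s k" "s l"] by simp
      moreover have "finite T" "k \<notin> T" "l \<notin> T" using kl T finite_subset[OF T(1)] by auto
      ultimately have "sum s (insert k (insert l T)) = h"
        using kl by simp
      then show ?thesis using T by (intro exI[of _ "insert k (insert l T)"]) (auto simp: U_def)
    qed
  qed
  have R: "R \<subseteq> I" "card R = 11"
    using U card_I finite_I by (auto simp: R_def card_Diff_subset finite_subset)
  have P_sum: "card A = 3 \<and> sum s A = - sum s U"
    if A: "A \<subseteq> R" "A \<noteq> {}" "card A \<le> 3" "sum s A \<in> P" for A
  proof -
    obtain T where T: "T \<subseteq> U" "sum s T = - sum s A" 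
      using P_rep[OF subgrp_uminus[OF P(1) A(4)]] by blast
    have "6 < card T + card A"
      using T A U R by (intro free_not_neg) (auto simp: R_def)
    moreover have "card T \<le> 4" using card_mono[OF _ T(1)] U by (metis card.infinite zero_neq_numeral)
    ultimately have "card T = 4" "card A = 3" using A by linarith+
    moreover have "finite U" using U by (auto simp: U_def)
    ultimately show ?thesis using T U card_subset_eq[of U T] by auto
  qed
  have RP: "s r \<notin> P" if "r \<in> R" for r
    using P_sum[of "{r}"] that by auto
  \<comment> \<open>Two terms from opposite classes would have their sum in \<open>P\<close>, but
    only sums of three terms can lie there.\<close>
  have one_sided: "cls P R v = {} \<or> cls P R (- v) = {}" if v: "v \<notin> P" for v
  proof (rule ccontr)
    assume "\<not> ?thesis"
    then obtain x y where xy: "x \<in> cls P R v" "y \<in> cls P R (- v)" by auto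
    have "v - - v \<notin> P" using not_double[OF P(1) v] by simp
    then have "x \<noteq> y" using cls_disjoint[OF P(1)] xy by blast
    moreover have "(s x - v) + (s y - - v) \<in> P" using xy by (intro subgrp_plus[OF P(1)]) (auto simp: cls_def)
    ultimately show False using P_sum[of "{x, y}"] xy by (auto simp: cls_def)
  qed
  have three_False: False if A: "A \<subseteq> R" "card A = 3" "\<And>x y. x \<in> A \<Longrightarrow> y \<in> A \<Longrightarrow> s x = s y" for A
  proof -
    obtain x where "x \<in> A" using A by fastforce
    then show False using three_equal[of A "s x"] A R by blast
  qed
  \<comment> \<open>Among four terms of one class any three have the same sum
    \<open>- sum s U\<close>, so all four are equal; but three equal terms sum to zero.\<close>
  have cls3: "card (cls P R v) \<le> 3" for v
  proof (rule ccontr)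
    assume "\<not> ?thesis"
    then obtain Q where Q: "Q \<subseteq> cls P R v" "card Q = 4"
      using obtain_subset_with_card_n[of 4 "cls P R v"] by auto
    have finQ: "finite Q" using Q by (intro card_ge_0_finite) auto
    have const: "s x = sum s Q + sum s U" if x: "x \<in> Q" for x
    proof -
      have c: "card (Q - {x}) = 3" and QR: "Q - {x} \<subseteq> R" using Q finQ x by (auto simp: cls_def)
      have "sum s (Q - {x}) \<in> P" using Q by (intro cls_three_sum[OF P(1) _ c]) auto
      then have "sum s (Q - {x}) = - sum s U"
        using P_sum[OF QR] c by (metis card.empty order_refl zero_neq_numeral)
      then have "sum s Q = s x + - sum s U" using sum.remove[OF finQ x, of s] by simp
      then show ?thesis by (simp only: add.assoc left_minus add_0_right)
    qed
    have "3 \<le> card Q" using Q by simp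
    then obtain A where A: "A \<subseteq> Q" "card A = 3" by (rule obtain_subset_with_card_n)
    show False
    proof (rule three_False)
      show "A \<subseteq> R" using A Q by (auto simp: cls_def)
      show "s x = s y" if "x \<in> A" "y \<in> A" for x y
        using const[of x] const[of y] A that by (simp only: subset_iff)
    qed (rule A(2))
  qed
  \<comment> \<open>With \<open>y\<close> and \<open>z\<close> fixed in the other two classes, every
    \<open>x\<close> in the first gives the same sum, so its three terms are equal.\<close>
  have full_False: False
    if v: "v1 - v2 \<notin> P" "v1 - v3 \<notin> P" "v2 - v3 \<notin> P" "v1 + v2 + v3 \<in> P"
      and c: "card (cls P R v1) = 3" "cls P R v2 \<noteq> {}" "cls P R v3 \<noteq> {}" for v1 v2 v3
  proof -
    obtain y z where yz: "y \<in> cls P R v2" "z \<in> cls P R v3" using c by auto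
    have "s x = - sum s U - (s y + s z)" if x: "x \<in> cls P R v1" for x
    proof -
      have d: "x \<noteq> y" "x \<noteq> z" "y \<noteq> z"
        using cls_disjoint[OF P(1) v(1) x yz(1)] cls_disjoint[OF P(1) v(2) x yz(2)]
          cls_disjoint[OF P(1) v(3) yz] by auto
      then have e: "sum s {x, y, z} = s x + s y + s z" by (simp add: add.assoc)
      have "{x, y, z} \<subseteq> R" using x yz by (auto simp: cls_def)
      then have "s x + s y + s z = - sum s U"
        using P_sum[of "{x, y, z}"] d cls_sum[OF P(1) v(4) x yz] e by simp
      then show ?thesis by (simp add: algebra_simps)
    qed
    then have "s x = s x'" if "x \<in> cls P R v1" "x' \<in> cls P R v1" for x x'
      using that by simp
    moreover have "cls P R v1 \<subseteq> R" by (auto simp: cls_def)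
    ultimately show False using three_False[OF _ c(1)] by blast
  qed
  obtain v1 v2 v3 where v: "v1 - v2 \<notin> P" "v1 - v3 \<notin> P" "v2 - v3 \<notin> P" "v1 + v2 + v3 \<in> P"
    "v1 \<notin> P" "v2 \<notin> P" "v3 \<notin> P"
    and maj: "\<And>v. v \<in> {v1, v2, v3} \<Longrightarrow> card (cls P R (- v)) \<le> card (cls P R v)"
    and tot: "card R \<le> 3 + (\<Sum>v\<leftarrow>[v1, v2, v3]. card (cls P R v) + card (cls P R (- v)))"
  proof (rule heavy_lines[OF P R(1) RP])
    show "11 \<le> card R" using R by simp
    show "card (cls P R v) + card (cls P R (- v)) \<le> 3" if "v \<notin> P" for v
      using one_sided[OF that] cls3[of v] cls3[of "- v"] by auto
  qed auto
  have neg0: "card (cls P R (- v)) = 0" if "v \<in> {v1, v2, v3}" for v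
    using maj[OF that] one_sided[of v] v that by fastforce
  \<comment> \<open>At least \<open>11 - 3 = 8\<close> indices lie in three classes of size at most
    3: all are occupied and one is full.\<close>
  have "8 \<le> card (cls P R v1) + card (cls P R v2) + card (cls P R v3)"
    using tot R neg0 by simp
  then have "0 < card (cls P R v1)" "0 < card (cls P R v2)" "0 < card (cls P R v3)"
    and full: "card (cls P R v1) = 3 \<or> card (cls P R v2) = 3 \<or> card (cls P R v3) = 3"
    using cls3[of v1] cls3[of v2] cls3[of v3] by linarith+
  then have "cls P R v1 \<noteq> {}" "cls P R v2 \<noteq> {}" "cls P R v3 \<noteq> {}" by auto
  moreover have "v2 - v1 \<notin> P" "v3 - v1 \<notin> P" "v3 - v2 \<notin> P"
    using v subgrp_uminus_iff[OF P(1)] by (metis minus_diff_eq)+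
  moreover have "v2 + v1 + v3 \<in> P" "v3 + v1 + v2 \<in> P" using v(4) by (simp_all add: ac_simps)
  ultimately show False
    using full_False[of v1 v2 v3] full_False[of v2 v1 v3] full_False[of v3 v1 v2] v full by blast
qed

text \<open>Modulo \<open>a\<close> the other 13 terms lie on distinct lines, hence on all 13 lines. So up to sign the classes
  of \<open>x + y\<close> and \<open>x - y\<close> occur together with those of \<open>x\<close> and \<open>y\<close>, and whatever the signs are, three
  of these four terms sum to zero modulo \<open>a\<close>; two copies of \<open>a\<close> complete this to a zero sum.\<close>

lemma repeated_False:
  assumes i: "i0 \<in> I" "i1 \<in> I" "i0 \<noteq> i1" "s i0 = a" "s i1 = a"
  shows False
proof -
  define H where "H = adjoin {0} a"
  define R where "R = I - {i0, i1}"
  define E where "E k = adjoin H (s k) - H" for k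
  have a: "a \<noteq> 0" using free_single i by blast
  have H: "subgrp H" "card H = 3" using line_subgrp card_line[OF a] by (auto simp: H_def)
  have R: "R \<subseteq> I" "card R = 13" "finite R"
    using i card_I finite_I by (auto simp: R_def card_Diff_subset)
  \<comment> \<open>Two copies of \<open>a\<close> suffice to cancel any element of
    \<open>H\<close>, and \<open>4 + 2 = 6\<close>.\<close>
  have H_sum: False if A: "A \<subseteq> R" "A \<noteq> {}" "card A \<le> 4" "sum s A \<in> H" for A
  proof -
    have "\<exists>T\<subseteq>{i0, i1}. sum s T = - sum s A"
    proof -
      consider "sum s A = 0" | "sum s A = - a" | "sum s A = a" using A by (auto simp: H_def line_cases)
      then show ?thesis
      proof cases
        case 1 then show ?thesis by (intro exI[of _ "{}"]) auto
      next
        case 2 then show ?thesis using i by (intro exI[of _ "{i0}"]) auto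
      next
        case 3 then show ?thesis using i double[of a] by (intro exI[of _ "{i0, i1}"]) auto
      qed
    qed
    then obtain T where T: "T \<subseteq> {i0, i1}" "sum s T = - sum s A" by blast
    have "card T \<le> 2" using card_mono[OF _ T(1)] i by auto
    moreover have "6 < card T + card A"
      using T A R i by (intro free_not_neg) (auto simp: R_def)
    ultimately show False using A by linarith
  qed
  have neg: "- v \<in> H \<longleftrightarrow> v \<in> H" for v using subgrp_uminus_iff[OF H(1)] .
  have diff_H: "s k - s l \<notin> H" if "k \<in> R" "l \<in> R" "k \<noteq> l" for k l
    using same_line_False[OF i, of l k] that by (auto simp: R_def H_def)
  have R1: "s k \<notin> H" if "k \<in> R" for k using H_sum[of "{k}"] that by auto
  have R2: "s k + s l \<notin> H" if "k \<in> R" "l \<in> R" for k l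
  proof (cases "k = l")
    case True then show ?thesis using not_double[OF H(1) R1] that by simp
  next
    case False then show ?thesis using H_sum[of "{k, l}"] that by auto
  qed
  have R3: "s k + s l + s m \<notin> H" if k: "k \<in> R" "l \<in> R" "m \<in> R" "\<not> (k = l \<and> l = m)" for k l m
  proof -
    \<comment> \<open>A repeated index turns the sum into a difference, which \<open>diff_H\<close>
      excludes.\<close>
    have two: "x + x + y \<in> H \<longleftrightarrow> y - x \<in> H" for x y by (simp add: double)
    consider "k = l" "k \<noteq> m" | "k = m" "k \<noteq> l" | "l = m" "k \<noteq> l" | "k \<noteq> l" "k \<noteq> m" "l \<noteq> m"
      using k by blast
    then show ?thesis
    proof cases
      case 1 then show ?thesis using two[of "s k" "s m"] diff_H k by auto
    next
      case 2 then show ?thesis using two[of "s k" "s l"] diff_H k by (auto simp: ac_simps)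
    next
      case 3 then show ?thesis using two[of "s l" "s k"] diff_H k by (auto simp: ac_simps)
    next
      case 4 then show ?thesis using H_sum[of "{k, l, m}"] k by (auto simp: add.assoc)
    qed
  qed
  have E: "v \<in> E k \<longleftrightarrow> v - s k \<in> H \<or> v + s k \<in> H" if "k \<in> R" for k v
  proof -
    have "v \<notin> H" if "v - s k \<in> H \<or> v + s k \<in> H"
      using that R1[OF \<open>k \<in> R\<close>] subgrp_diff[OF H(1), of v "v - s k"] subgrp_diff[OF H(1), of "v + s k" v] by auto
    then show ?thesis by (auto simp: E_def adjoin_def)
  qed
  have card_E: "card (E k) = 6" if "k \<in> R" for k
    using card_adjoin[OF H(1) R1[OF that]] H subset_adjoin[of H "s k"]
    by (simp add: E_def card_Diff_subset)
  have "E k \<inter> E l = {}" if kl: "k \<in> R" "l \<in> R" "k \<noteq> l" for k l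
  proof (rule ccontr)
    assume "E k \<inter> E l \<noteq> {}"
    then obtain v where v: "v - s k \<in> H \<or> v + s k \<in> H" "v - s l \<in> H \<or> v + s l \<in> H"
      using E kl by blast
    have e: "(v - s l) - (v - s k) = s k - s l" "(v + s l) - (v - s k) = s k + s l"
      "(v - s l) - (v + s k) = - (s k + s l)" "(v + s l) - (v + s k) = s l - s k"
      by (simp_all add: algebra_simps)
    have "s k - s l \<in> H \<or> s k + s l \<in> H \<or> - (s k + s l) \<in> H \<or> s l - s k \<in> H"
      using v subgrp_diff[OF H(1)] e by metis
    then show False using neg[of "s k + s l"] R2[OF kl(1,2)] diff_H[of k l] diff_H[of l k] kl by auto
  qed
  \<comment> \<open>Thirteen disjoint sets of six elements, with the three of \<open>H\<close>, make
    up all \<open>81\<close>.\<close>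
  then have "card (\<Union>k\<in>R. E k) = 78"
    using R card_E by (subst card_UN_disjoint) auto
  moreover have "H \<inter> (\<Union>k\<in>R. E k) = {}" by (auto simp: E_def)
  ultimately have "card (H \<union> (\<Union>k\<in>R. E k)) = card (UNIV :: 'v set)"
    using H card_group by (subst card_Un_disjoint) auto
  then have cover: "H \<union> (\<Union>k\<in>R. E k) = UNIV" by (intro card_subset_eq) auto
  have cover': "\<exists>k\<in>R. v - s k \<in> H \<or> v + s k \<in> H" if "v \<notin> H" for v
  proof -
    have "v \<in> H \<union> (\<Union>k\<in>R. E k)" using cover by simp
    then show ?thesis using that E by auto
  qed
  obtain k where k: "k \<in> R" using R by fastforce
  have "R - {k} \<noteq> {}" using R k by (metis card_Diff_singleton card.empty diff_is_0_eq numeral_le_one_iff semiring_norm(70))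
  then obtain l where l: "l \<in> R" "l \<noteq> k" by blast
  obtain m where m: "m \<in> R" "s k + s l - s m \<in> H \<or> s k + s l + s m \<in> H"
    using cover' R2[OF k l(1)] by blast
  have m': "s k + s l - s m \<in> H" using R3[of k l m] m k l by auto
  obtain n where n: "n \<in> R" "s k - s l - s n \<in> H \<or> s k - s l + s n \<in> H"
    using cover' diff_H[of k l] k l by blast
  show False
  \<comment> \<open>Modulo \<open>H\<close>, \<open>s m = s k + s l\<close> and \<open>s n\<close>
    is \<open>s k - s l\<close> or its negative. Thus \<open>s m + s n\<close> is
    \<open>s k + s k = - s k\<close> or \<open>s l + s l = - s l\<close>, against \<open>R3\<close>,
    which excludes every triple of indices not all equal.\<close>
  proof (cases "s k - s l - s n \<in> H")
    case True
    have "- ((s k + s l - s m) + (s k - s l - s n)) \<in> H"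
      using m' True by (simp only: neg subgrp_plus[OF H(1)])
    moreover have "- ((s k + s l - s m) + (s k - s l - s n)) = - (s k + s k) + s m + s n"
      by (simp add: algebra_simps)
    moreover have "m \<noteq> k" using m' R1[OF l(1)] by auto
    ultimately show False using R3[of k m n] k m(1) n(1) by (simp only: double minus_minus) blast
  next
    case False
    then have "s k - s l + s n \<in> H" using n by blast
    from subgrp_diff[OF H(1) this m'] have "(s k - s l + s n) - (s k + s l - s m) \<in> H" .
    moreover have "(s k - s l + s n) - (s k + s l - s m) = - (s l + s l) + s m + s n"
      by (simp add: algebra_simps)
    moreover have "m \<noteq> l" using m' R1[OF k] by auto
    ultimately show False using R3[of l m n] l m(1) n(1) by (simp only: double minus_minus) blast
  qed
qed


section \<open>Pairwise distinct terms\<close>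

lemma inj: "inj_on s I"
  using repeated_False by (auto simp: inj_on_def)

text \<open>Each of the 14 other terms spans with \<open>s i\<close> a plane having six elements
  outside the line of \<open>s i\<close>. As \<open>14 * 6 = 84 > 81\<close>, two such sets meet, so
  \<open>s k - s l\<close> or \<open>s k + s l\<close> is on that line. Freeness and injectivity
  leave only relations of the wanted form.\<close>

lemma collinear_triple:
  obtains i j c where "i \<in> I" "j \<in> I" "c \<in> I" "i \<noteq> j" "s c = s i + s j"
proof -
  obtain i where i: "i \<in> I" using card_I by fastforce
  define H where "H = adjoin {0} (s i)"
  define R where "R = I - {i}"
  define E where "E k = adjoin H (s k) - H" for k
  have H: "subgrp H" "card H = 3" using line_subgrp card_line[OF free_single[OF i]] by (auto simp: H_def)
  have R: "card R = 14" "finite R" using card_I finite_I i by (auto simp: R_def)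
  have R1: "s k \<notin> H" if "k \<in> R" for k
  proof
    assume "s k \<in> H"
    then consider "s k = 0" | "s k = s i" | "s k = - s i" by (auto simp: H_def line_cases)
    then show False
      using that i free_single[of k] free_pair[of i k] inj by cases (auto simp: R_def inj_on_def)
  qed
  have card_E: "card (E k) = 6" if "k \<in> R" for k
    using card_adjoin[OF H(1) R1[OF that]] H subset_adjoin[of H "s k"]
    by (simp add: E_def card_Diff_subset)
  have "\<exists>k\<in>R. \<exists>l\<in>R. k \<noteq> l \<and> E k \<inter> E l \<noteq> {}"
  proof (rule ccontr)
    assume "\<not> ?thesis"
    then have "card (\<Union>k\<in>R. E k) = 84"
      using R card_E by (subst card_UN_disjoint) auto
    moreover have "card (\<Union>k\<in>R. E k) \<le> card (UNIV :: 'v set)" by (intro card_mono) auto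
    ultimately show False using card_group by simp
  qed
  then obtain k l v where kl: "k \<in> R" "l \<in> R" "k \<noteq> l" "v \<in> E k" "v \<in> E l" by blast
  have v: "v - s k \<in> H \<or> v + s k \<in> H" "v - s l \<in> H \<or> v + s l \<in> H"
    using kl by (auto simp: E_def adjoin_def)
  have e: "(v - s l) - (v - s k) = s k - s l" "(v + s l) - (v - s k) = s k + s l"
    "(v + s k) - (v - s l) = s k + s l" "(v + s k) - (v + s l) = s k - s l"
    by (simp_all add: algebra_simps)
  have "s k - s l \<in> H \<or> s k + s l \<in> H"
    using v subgrp_diff[OF H(1)] e by metis
  then consider "s k - s l = 0" | "s k - s l = s i" | "s k - s l = - s i"
    | "s k + s l = 0" | "s k + s l = s i" | "s k + s l = - s i"
    by (auto simp: H_def line_cases)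
  then show thesis
  proof cases
    case 1
    then show thesis using kl inj by (auto simp: R_def inj_on_def)
  next
    case 2
    then have "s k = s i + s l" by (simp add: algebra_simps)
    then show thesis using that[of i l k] kl i by (auto simp: R_def)
  next
    case 3
    then have "s l = s i + s k" by (simp add: algebra_simps)
    then show thesis using that[of i k l] kl i by (auto simp: R_def)
  next
    case 4
    then show thesis using free_pair[of k l] kl by (auto simp: R_def)
  next
    case 5
    then show thesis using that[of k l i] kl i by (auto simp: R_def)
  next
    case 6
    then show thesis using free_triple[of k l i] kl i by (auto simp: R_def)
  qed
qed

lemma card_translates_le:
  assumes "X \<subseteq> I" "\<And>x. x \<in> X \<Longrightarrow> s x + t \<in> {a, b}"
  shows "card X \<le> 2"
proof -
  have "card X = card ((\<lambda>x. s x + t) ` X)"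
    using inj_on_subset[OF inj assms(1)] by (intro card_image[symmetric]) (auto simp: inj_on_def)
  also have "\<dots> \<le> card {a, b}" using assms by (intro card_mono) auto
  also have "\<dots> \<le> 2" by (simp add: card_insert_if)
  finally show ?thesis .
qed

text \<open>In a 2 by 2 array of sums, entries in one row or column differ, so with two values the
  diagonals are constant. Adding the two equations gives \<open>s y + s y = s y' + s y'\<close>,
  hence \<open>s y = s y'\<close>.\<close>

lemma grid_False:
  assumes X: "X \<subseteq> I" "2 \<le> card X" and Y: "Y \<subseteq> I" "2 \<le> card Y"
    and ab: "\<And>x y. x \<in> X \<Longrightarrow> y \<in> Y \<Longrightarrow> s x + s y + t \<in> {a, b}"
  shows False
proof -
  obtain x x' where x: "{x, x'} \<subseteq> X" "x \<noteq> x'"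
    using obtain_subset_with_card_n[OF X(2)] by (metis card_2_iff)
  obtain y y' where y: "{y, y'} \<subseteq> Y" "y \<noteq> y'"
    using obtain_subset_with_card_n[OF Y(2)] by (metis card_2_iff)
  have sx: "s x \<noteq> s x'" and sy: "s y \<noteq> s y'"
    using x y X(1) Y(1) by (simp_all add: inj_on_eq_iff[OF inj] subset_iff)
  have 1: "s x + s y + t \<in> {a, b}" "s x' + s y + t \<in> {a, b}" "s x + s y' + t \<in> {a, b}" "s x' + s y' + t \<in> {a, b}"
    using ab x y by blast+
  have 2: "s x + s y + t \<noteq> s x' + s y + t" "s x + s y + t \<noteq> s x + s y' + t"
    "s x' + s y' + t \<noteq> s x + s y' + t" "s x' + s y' + t \<noteq> s x' + s y + t"
    using sx sy by simp_all
  have "s x + s y + t = s x' + s y' + t" "s x' + s y + t = s x + s y' + t"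
    using 1 2 by (metis empty_iff insert_iff)+
  then have 3: "s x + s y = s x' + s y'" "s x' + s y = s x + s y'" by simp_all
  have "s y + s y = (s x + s y) + (s x' + s y) - s x - s x'" by (simp add: algebra_simps)
  also have "\<dots> = s y' + s y'" unfolding 3 by (simp add: algebra_simps)
  finally have "- s y = - s y'" by (simp only: double)
  then show False using sy by simp
qed

text \<open>Let \<open>P\<close> be the plane spanned by \<open>s i\<close> and \<open>s j\<close>. Together with \<open>s c = s i + s j\<close> these represent the
  negative of every other element of \<open>P\<close>, so a sum of at most three further terms takes at most the
  two values \<open>s i\<close>, \<open>s j\<close> in \<open>P\<close>.\<close>

lemma contradiction: False
proof -
  obtain i j c where ijc: "i \<in> I" "j \<in> I" "c \<in> I" "i \<noteq> j" "s c = s i + s j"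
    by (rule collinear_triple)
  define H where "H = adjoin {0} (s i)"
  define P where "P = adjoin H (s j)"
  define U where "U = {i, j, c}"
  define R where "R = I - U"
  have nz: "s i \<noteq> 0" "s j \<noteq> 0" using free_single ijc by blast+
  have ne: "c \<noteq> i" "c \<noteq> j" using ijc nz by auto
  have H: "subgrp H" "card H = 3" using line_subgrp card_line[OF nz(1)] by (auto simp: H_def)
  have "s j \<noteq> s i" "s j \<noteq> - s i"
    using ijc inj free_pair[of i j] by (auto simp: inj_on_def)
  then have "s j \<notin> H" using nz by (simp add: H_def line_cases)
  then have P: "subgrp P" "card P = 9"
    using H by (simp_all add: P_def adjoin_subgrp card_adjoin)
  have U: "U \<subseteq> I" "card U = 3" using ijc ne by (auto simp: U_def)
  have R: "R \<subseteq> I" "card R = 12"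
    using U card_I finite_I by (auto simp: R_def card_Diff_subset finite_subset)
  have P_rep: "\<exists>T\<subseteq>U. sum s T = - h" if h: "h \<in> P" "h \<notin> {s i, s j}" for h
  proof -
    have "h \<in> H \<or> h - s j \<in> H \<or> h + s j \<in> H" using h by (auto simp: P_def adjoin_def)
    then consider "h = 0" | "h = - s i" | "h = s j + s i" | "h = s j - s i"
      | "h = - s j" | "h = s i - s j" | "h = - s i - s j"
      using h(2) by (auto simp: H_def line_cases algebra_simps eq_neg_iff_add_eq_0)
    then show ?thesis
    proof cases
      case 1 then show ?thesis by (intro exI[of _ "{}"]) auto
    next
      case 2 then show ?thesis by (intro exI[of _ "{i}"]) (auto simp: U_def)
    next
      case 3
      have "sum s {i, j, c} = (s i + s i) + (s j + s j)" using ijc ne by (simp add: algebra_simps)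
      then show ?thesis using 3 by (intro exI[of _ "{i, j, c}"]) (auto simp: U_def double)
    next
      case 4
      have "sum s {j, c} = s i + (s j + s j)" using ijc ne by (simp add: algebra_simps)
      then show ?thesis using 4 by (intro exI[of _ "{j, c}"]) (auto simp: U_def double)
    next
      case 5 then show ?thesis by (intro exI[of _ "{j}"]) (auto simp: U_def)
    next
      case 6
      have "sum s {i, c} = (s i + s i) + s j" using ijc ne by (simp add: algebra_simps)
      then show ?thesis using 6 by (intro exI[of _ "{i, c}"]) (auto simp: U_def double)
    next
      case 7 then show ?thesis using ijc by (intro exI[of _ "{c}"]) (auto simp: U_def)
    qed
  qed
  have P_sum: "sum s A \<in> {s i, s j}"
    if A: "A \<subseteq> R" "A \<noteq> {}" "card A \<le> 3" "sum s A \<in> P" for A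
  proof (rule ccontr)
    assume "\<not> ?thesis"
    then obtain T where T: "T \<subseteq> U" "sum s T = - sum s A" using P_rep[OF A(4)] by blast
    have "6 < card T + card A"
      using T A U R by (intro free_not_neg) (auto simp: R_def)
    moreover have "card T \<le> 3" using card_mono[OF _ T(1)] U by (metis card.infinite zero_neq_numeral)
    ultimately show False using A by linarith
  qed
  have RP: "s r \<notin> P" if r: "r \<in> R" for r
  proof
    assume "s r \<in> P"
    then have "s r \<in> {s i, s j}" using P_sum[of "{r}"] r by auto
    then show False using r ijc inj by (auto simp: inj_on_def R_def U_def)
  qed
  have clsI: "cls P R v \<subseteq> I" for v using R by (auto simp: cls_def)
  have pair: "s x + s y + 0 \<in> {s i, s j}"
    if v: "v \<notin> P" and xy: "x \<in> cls P R v" "y \<in> cls P R (- v)" for v x y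
  proof -
    have "v - - v \<notin> P" using not_double[OF P(1) v] by simp
    then have "x \<noteq> y" using cls_disjoint[OF P(1)] xy by blast
    moreover have "(s x - v) + (s y - - v) \<in> P" using xy by (intro subgrp_plus[OF P(1)]) (auto simp: cls_def)
    ultimately show ?thesis using P_sum[of "{x, y}"] xy by (auto simp: cls_def)
  qed
  have cls3: "card (cls P R v) \<le> 3" for v
  proof (rule ccontr)
    assume "\<not> ?thesis"
    then obtain Q where Q: "Q \<subseteq> cls P R v" "card Q = 4"
      using obtain_subset_with_card_n[of 4 "cls P R v"] by auto
    have finQ: "finite Q" using Q by (intro card_ge_0_finite) auto
    \<comment> \<open>Each term of \<open>Q\<close> is the total minus a sum of three in
      \<open>P\<close>, so four distinct terms would take only two values.\<close>
    have "s x + (- sum s Q) \<in> {- s i, - s j}" if x: "x \<in> Q" for x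
    proof -
      have c: "card (Q - {x}) = 3" and QR: "Q - {x} \<subseteq> R" using Q finQ x by (auto simp: cls_def)
      have "sum s (Q - {x}) \<in> P" using Q by (intro cls_three_sum[OF P(1) _ c]) auto
      then have "sum s (Q - {x}) \<in> {s i, s j}"
        using P_sum[OF QR] c by (metis card.empty order_refl zero_neq_numeral)
      then show ?thesis using sum.remove[OF finQ x, of s] by auto
    qed
    moreover have "Q \<subseteq> I" using Q clsI by blast
    ultimately have "card Q \<le> 2" by (rule card_translates_le[rotated])
    then show False using Q by simp
  qed
  \<comment> \<open>If both classes are occupied, sums of opposite pairs take at most two values:
    each class has at most two elements, and \<open>grid_False\<close> forbids two in both.\<close>
  have line: "card (cls P R v) + card (cls P R (- v)) \<le> 3" if v: "v \<notin> P" for v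
  proof (cases "cls P R v = {} \<or> cls P R (- v) = {}")
    case True
    then show ?thesis using cls3[of v] cls3[of "- v"] by auto
  next
    case False
    then obtain x y where xy: "x \<in> cls P R v" "y \<in> cls P R (- v)" by blast
    have "card (cls P R v) \<le> 2"
      using pair[OF v _ xy(2)] by (intro card_translates_le[OF clsI]) auto
    moreover have "card (cls P R (- v)) \<le> 2"
      using pair[OF v xy(1)] by (intro card_translates_le[OF clsI, where t = "s x"]) (auto simp: add.commute)
    moreover have "\<not> (2 \<le> card (cls P R v) \<and> 2 \<le> card (cls P R (- v)))"
      using grid_False[OF clsI _ clsI _ pair[OF v]] by blast
    ultimately show ?thesis by linarith
  qed
  obtain v1 v2 v3 where v: "v1 - v2 \<notin> P" "v1 - v3 \<notin> P" "v2 - v3 \<notin> P" "v1 + v2 + v3 \<in> P"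
    "v1 \<notin> P" "v2 \<notin> P" "v3 \<notin> P"
    and maj: "\<And>v. v \<in> {v1, v2, v3} \<Longrightarrow> card (cls P R (- v)) \<le> card (cls P R v)"
    and tot: "card R \<le> 3 + (\<Sum>v\<leftarrow>[v1, v2, v3]. card (cls P R v) + card (cls P R (- v)))"
  proof (rule heavy_lines[OF P R(1) RP])
    show "11 \<le> card R" using R by simp
  qed (use line in auto)
  \<comment> \<open>The three lines carry at least \<open>12 - 3 = 9\<close> indices and at most
    three each, so each majority class has at least two.\<close>
  have "9 \<le> (card (cls P R v1) + card (cls P R (- v1))) + (card (cls P R v2) + card (cls P R (- v2)))
      + (card (cls P R v3) + card (cls P R (- v3)))"
    using tot R by simp
  then have two: "2 \<le> card (cls P R v1)" "2 \<le> card (cls P R v2)" "2 \<le> card (cls P R v3)"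
    using line[OF v(5)] line[OF v(6)] line[OF v(7)] maj[of v1] maj[of v2] maj[of v3]
    by simp_all
  then obtain z where z: "z \<in> cls P R v3" by fastforce
  show False
  proof (rule grid_False[OF clsI two(1) clsI two(2)])
    fix x y assume xy: "x \<in> cls P R v1" "y \<in> cls P R v2"
    have d: "x \<noteq> y" "x \<noteq> z" "y \<noteq> z"
      using cls_disjoint[OF P(1) v(1) xy] cls_disjoint[OF P(1) v(2) xy(1) z]
        cls_disjoint[OF P(1) v(3) xy(2) z] by auto
    then have "sum s {x, y, z} = s x + s y + s z" by (simp add: add.assoc)
    moreover have "{x, y, z} \<subseteq> R" using xy z by (auto simp: cls_def)
    moreover have "card {x, y, z} \<le> 3" using d by simp
    ultimately show "s x + s y + s z \<in> {s i, s j}"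
      using P_sum[of "{x, y, z}"] cls_sum[OF P(1) v(4) xy z] by (metis insert_not_empty)
  qed
qed

end

subsection \<open>Passing to higher dimensions\<close>

lemma of_int_3_eq_0: "(of_int n :: 3) = 0 \<longleftrightarrow> 3 dvd n"
  using of_int_eq_0_iff_char_dvd[of n, where 'a = 3] by simp

text \<open>Reduction modulo 3 moves the vectors to the fourth power of the type \<open>3\<close>, a
  group of order 81 in which \<open>short_free\<close> is refuted.\<close>

lemma zero_sum_dim4_3:
  assumes J: "finite J" "card J = 4" and I: "card I = 15"
  obtains A where "A \<subseteq> I" "A \<noteq> {}" "zero_sum 3 J x A" "card A \<le> 6"
proof (rule ccontr)
  note found = that
  assume no: "\<not> thesis"
  obtain a b c e where abce: "J = {a, b, c, e}"
    using J(2) by (auto simp: card_Suc_eq numeral_eq_Suc)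
  define s where "s i = (of_int (x i a) :: 3, of_int (x i b) :: 3, of_int (x i c) :: 3, of_int (x i e) :: 3)" for i
  have sum_s: "sum s A = (of_int (\<Sum>i\<in>A. x i a), of_int (\<Sum>i\<in>A. x i b), of_int (\<Sum>i\<in>A. x i c), of_int (\<Sum>i\<in>A. x i e))" for A
    by (induction A rule: infinite_finite_induct) (auto simp: s_def zero_prod_def)
  have "(3 :: 3) = 0" using of_int_3_eq_0[of 3] by simp
  then have 3: "3 * y = 0" for y :: 3 by (simp only: mult_zero_left)
  interpret short_free s I
  proof
    show "y + y + y = 0" for y :: "3 \<times> 3 \<times> 3 \<times> 3"
      by (simp add: prod_eq_iff 3)
    show "sum s A \<noteq> 0" if "A \<subseteq> I" "A \<noteq> {}" "card A \<le> 6" for A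
    proof
      assume "sum s A = 0"
      then have "zero_sum 3 J x A"
        unfolding sum_s zero_prod_def by (simp add: abce zero_sum_def of_int_3_eq_0 del: of_int_sum)
      then show False using found that no by blast
    qed
  qed (use I in simp_all)
  show False by (rule contradiction)
qed

section \<open>Hyperplanes containing many terms\<close>

definition vanishing :: "nat \<Rightarrow> 'j set \<Rightarrow> ('i \<Rightarrow> 'j \<Rightarrow> int) \<Rightarrow> 'i set \<Rightarrow> ('j \<Rightarrow> int) \<Rightarrow> 'i set" where
  "vanishing p J x I f = {i \<in> I. int p dvd (\<Sum>j\<in>J. f j * x i j)}"

text \<open>If \<open>x j\<close> is invertible modulo \<open>p\<close>, any choice of the other
  coefficients extends by solving for the one at \<open>j\<close>. If \<open>x\<close> vanishes
  modulo \<open>p\<close>, all functionals count.\<close>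

lemma card_functionals_ge:
  assumes p: "prime p" and J: "finite J" "J \<noteq> {}"
  shows "p ^ (card J - 1) \<le> card {f \<in> J \<rightarrow>\<^sub>E {0..<int p}. int p dvd (\<Sum>j\<in>J. f j * x j)}"
    (is "_ \<le> card ?K")
proof (cases "\<forall>j\<in>J. int p dvd x j")
  case True
  then have "?K = (J \<rightarrow>\<^sub>E {0..<int p})" by (auto intro!: dvd_sum)
  then have "card ?K = p ^ card J" using J by (simp add: card_PiE)
  then show ?thesis using prime_gt_0_nat[OF p] by (simp add: power_increasing)
next
  case False
  then obtain j where j: "j \<in> J" "\<not> int p dvd x j" by blast
  then have "coprime (x j) (int p)"
    using p by (metis coprime_commute prime_imp_coprime prime_nat_int_transfer)
  then obtain y where y: "[x j * y = 1] (mod int p)" using cong_solve_coprime_int by blast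
  have fin: "finite ?K" using J by (intro finite_subset[OF _ finite_PiE[of J "\<lambda>_. {0..<int p}"]]) auto
  have "(J - {j} \<rightarrow>\<^sub>E {0..<int p}) \<subseteq> (\<lambda>f. restrict f (J - {j})) ` ?K"
  proof
    fix g assume g: "g \<in> J - {j} \<rightarrow>\<^sub>E {0..<int p}"
    define S where "S = (\<Sum>k\<in>J - {j}. g k * x k)"
    define f where "f = g(j := (- S * y) mod int p)"
    have "(\<Sum>k\<in>J. f k * x k) = f j * x j + (\<Sum>k\<in>J - {j}. f k * x k)"
      using J j by (simp add: sum.remove)
    also have "(\<Sum>k\<in>J - {j}. f k * x k) = S"
      unfolding S_def f_def by (intro sum.cong) auto
    finally have "(\<Sum>k\<in>J. f k * x k) = ((- S * y) mod int p) * x j + S"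
      by (simp add: f_def)
    also have "[\<dots> = (- S * y) * x j + S] (mod int p)"
      by (intro cong_add cong_mult cong_refl) (simp add: cong_def)
    also have "(- S * y) * x j + S = S * (1 - x j * y)" by (simp add: algebra_simps)
    also have "[\<dots> = S * 0] (mod int p)"
      using y by (intro cong_mult cong_refl) (simp add: cong_0_iff cong_iff_dvd_diff dvd_diff_commute)
    finally have "int p dvd (\<Sum>k\<in>J. f k * x k)" by (simp add: cong_0_iff)
    moreover have "f \<in> J \<rightarrow>\<^sub>E {0..<int p}"
      using g j prime_gt_0_nat[OF p] by (auto simp: f_def PiE_iff extensional_def)
    moreover have "restrict f (J - {j}) = g"
      using g by (auto simp: f_def PiE_iff extensional_def restrict_def)
    ultimately show "g \<in> (\<lambda>f. restrict f (J - {j})) ` ?K" by force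
  qed
  from surj_card_le[OF fin this] show ?thesis
    using J j by (simp add: card_PiE)
qed

text \<open>Double counting of pairs of a term and a nonzero functional killing it: some functional
  does at least as well as the average.\<close>

lemma heavy_hyperplane:
  assumes p: "prime p" and J: "finite J" "J \<noteq> {}" and I: "finite I"
  obtains f j where "j \<in> J" "\<not> int p dvd f j"
    "card I * (p ^ (card J - 1) - 1) \<le> card (vanishing p J x I f) * (p ^ card J - 1)"
proof -
  define F where "F = (J \<rightarrow>\<^sub>E {0..<int p}) - {\<lambda>j\<in>J. 0}"
  have p1: "1 < p" using p prime_gt_1_nat by blast
  have zF: "(\<lambda>j\<in>J. 0) \<in> J \<rightarrow>\<^sub>E {0..<int p}" using p1 by auto
  have finF: "finite F" unfolding F_def using J by (intro finite_Diff finite_PiE) auto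
  have cF: "card F = p ^ card J - 1"
    unfolding F_def using J zF by (subst card_Diff_singleton) (auto simp: card_PiE)
  have F0: "0 < card F"
    unfolding cF using one_less_power[OF p1, of "card J"] J by (simp add: card_gt_0_iff)
  have each: "p ^ (card J - 1) - 1 \<le> card {f \<in> F. int p dvd (\<Sum>j\<in>J. f j * x i j)}" for i
  proof -
    let ?K = "{f \<in> J \<rightarrow>\<^sub>E {0..<int p}. int p dvd (\<Sum>j\<in>J. f j * x i j)}"
    have "{f \<in> F. int p dvd (\<Sum>j\<in>J. f j * x i j)} = ?K - {\<lambda>j\<in>J. 0}" by (auto simp: F_def)
    moreover have "(\<lambda>j\<in>J. 0) \<in> ?K" using zF by auto
    ultimately have "card {f \<in> F. int p dvd (\<Sum>j\<in>J. f j * x i j)} = card ?K - 1"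
      by (simp add: card_Diff_singleton)
    then show ?thesis using card_functionals_ge[OF p J, of "x i"] by linarith
  qed
  have "\<exists>f\<in>F. card I * (p ^ (card J - 1) - 1) \<le> card (vanishing p J x I f) * (p ^ card J - 1)"
  proof (rule ccontr)
    assume "\<not> ?thesis"
    then have less: "card (vanishing p J x I f) * card F < card I * (p ^ (card J - 1) - 1)" if "f \<in> F" for f
      using that by (auto simp: cF not_le)
    have "card I * (p ^ (card J - 1) - 1) * card F = (\<Sum>i\<in>I. (p ^ (card J - 1) - 1)) * card F"
      by simp
    also have "\<dots> \<le> (\<Sum>i\<in>I. card {f \<in> F. int p dvd (\<Sum>j\<in>J. f j * x i j)}) * card F"
      by (intro mult_right_mono sum_mono each) auto
    also have "(\<Sum>i\<in>I. card {f \<in> F. int p dvd (\<Sum>j\<in>J. f j * x i j)}) = (\<Sum>f\<in>F. card (vanishing p J x I f))"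
      unfolding vanishing_def using sum_multicount_gen[OF I finF, of "\<lambda>i f. int p dvd (\<Sum>j\<in>J. f j * x i j)"]
      by simp
    also have "\<dots> * card F = (\<Sum>f\<in>F. card (vanishing p J x I f) * card F)"
      by (simp add: sum_distrib_right)
    also have "\<dots> < (\<Sum>f\<in>F. card I * (p ^ (card J - 1) - 1))"
      using F0 finF less by (intro sum_strict_mono) auto
    finally show False by (simp add: mult.commute)
  qed
  then obtain f where f: "f \<in> F" "card I * (p ^ (card J - 1) - 1) \<le> card (vanishing p J x I f) * (p ^ card J - 1)"
    by blast
  then have "f \<noteq> (\<lambda>j\<in>J. 0)" "f \<in> J \<rightarrow>\<^sub>E {0..<int p}" by (auto simp: F_def)
  then obtain j where "j \<in> J" "f j \<noteq> 0" "0 \<le> f j" "f j < int p"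
    by (auto simp: PiE_iff extensional_def fun_eq_iff restrict_def split: if_splits)
  then show thesis using that[of j f] f zdvd_not_zless[of "f j" "int p"] by auto
qed

text \<open>On the hyperplane the coordinate \<open>j\<close> is determined by the others, since
  \<open>f j\<close> is invertible modulo \<open>p\<close>.\<close>

lemma zero_sum_kernel:
  assumes p: "prime p" and J: "finite J" and j: "j \<in> J" "\<not> int p dvd f j"
    and A: "A \<subseteq> vanishing p J x I f" "zero_sum p (J - {j}) x A"
  shows "zero_sum p J x A"
proof -
  have "int p dvd (\<Sum>i\<in>A. \<Sum>k\<in>J. f k * x i k)"
    using A by (intro dvd_sum[of A]) (auto simp: vanishing_def)
  also have "(\<Sum>i\<in>A. \<Sum>k\<in>J. f k * x i k) = (\<Sum>k\<in>J. f k * (\<Sum>i\<in>A. x i k))"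
    by (subst sum.swap) (simp add: sum_distrib_left)
  also have "\<dots> = f j * (\<Sum>i\<in>A. x i j) + (\<Sum>k\<in>J - {j}. f k * (\<Sum>i\<in>A. x i k))"
    using J j by (simp add: sum.remove)
  finally have "int p dvd f j * (\<Sum>i\<in>A. x i j) + (\<Sum>k\<in>J - {j}. f k * (\<Sum>i\<in>A. x i k))" .
  moreover have "int p dvd (\<Sum>k\<in>J - {j}. f k * (\<Sum>i\<in>A. x i k))"
    using A(2) by (intro dvd_sum[of "J - {j}"] dvd_mult) (auto simp: zero_sum_def)
  ultimately have "int p dvd f j * (\<Sum>i\<in>A. x i j)"
    by (simp only: dvd_add_left_iff)
  then have "int p dvd (\<Sum>i\<in>A. x i j)"
    using j p by (simp add: prime_dvd_mult_iff)
  then show ?thesis using A(2) by (auto simp: zero_sum_def)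
qed

section \<open>Induction on the dimension\<close>

definition short_bound :: "nat \<Rightarrow> nat \<Rightarrow> nat \<Rightarrow> nat \<Rightarrow> bool" where
  "short_bound p k d n \<longleftrightarrow> (\<forall>(J::nat set) (I::nat set) x. finite J \<and> card J = d \<and> finite I \<and> n \<le> card I \<longrightarrow>
     (\<exists>A\<subseteq>I. A \<noteq> {} \<and> card A \<le> k \<and> zero_sum p J x A))"

text \<open>Sets with more than \<open>n\<close> elements count in \<open>short_bound\<close>
  because a hyperplane may hold more terms than required; here they are cut down to exactly
  \<open>n\<close>.\<close>

lemma short_boundI:
  assumes "\<And>(J::nat set) (I::nat set) x. finite J \<Longrightarrow> card J = d \<Longrightarrow> finite I \<Longrightarrow> card I = n \<Longrightarrow>
    \<exists>A\<subseteq>I. A \<noteq> {} \<and> card A \<le> k \<and> zero_sum p J x A"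
  shows "short_bound p k d n"
  unfolding short_bound_def
proof (intro allI impI, elim conjE)
  fix J I :: "nat set" and x
  assume J: "finite J" "card J = d" and I: "finite I" "n \<le> card I"
  obtain I' where I': "I' \<subseteq> I" "card I' = n" "finite I'"
    using obtain_subset_with_card_n[OF I(2)] by blast
  show "\<exists>A\<subseteq>I. A \<noteq> {} \<and> card A \<le> k \<and> zero_sum p J x A"
    using assms[OF J I'(3,2), of x] I'(1) by (meson order_trans)
qed

lemma short_bound_kernel:
  assumes p: "prime p" and b: "short_bound p k d n" and J: "finite (J :: nat set)" "card J = d + 1"
    and I: "finite (I :: nat set)" and j: "j \<in> J" "\<not> int p dvd f j" and big: "n \<le> card (vanishing p J x I f)"
  shows "\<exists>A\<subseteq>I. A \<noteq> {} \<and> card A \<le> k \<and> zero_sum p J x A"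
proof -
  have "finite (J - {j})" "card (J - {j}) = d" "finite (vanishing p J x I f)"
    using J j I by (simp_all add: vanishing_def)
  then obtain A where "A \<subseteq> vanishing p J x I f" "A \<noteq> {}" "card A \<le> k" "zero_sum p (J - {j}) x A"
    using b big unfolding short_bound_def by blast
  moreover from this have "zero_sum p J x A" using zero_sum_kernel[where f = f, OF p J(1) j] by blast
  moreover have "vanishing p J x I f \<subseteq> I" by (auto simp: vanishing_def)
  ultimately show ?thesis by blast
qed

text \<open>Averaging yields more than \<open>N\<close> terms on a hyperplane when
  \<open>(N * p + 1) * (p ^ d - 1) > N * (p ^ (d + 1) - 1)\<close>, which rearranges to the
  assumption on \<open>N\<close>.\<close>

lemma short_bound_Suc:
  assumes p: "prime p" and b: "short_bound p k d (N + 1)" and N: "N * (p - 1) < p ^ d - 1"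
  shows "short_bound p k (d + 1) (N * p + 1)"
proof (rule short_boundI)
  fix J I :: "nat set" and x
  assume J: "finite J" "card J = d + 1" and I: "finite I" "card I = N * p + 1"
  have "J \<noteq> {}" using J by auto
  then obtain f j where f: "j \<in> J" "\<not> int p dvd f j"
    "card I * (p ^ (card J - 1) - 1) \<le> card (vanishing p J x I f) * (p ^ card J - 1)"
    using heavy_hyperplane[OF p J(1) _ I(1)] by blast
  have "N < card (vanishing p J x I f)"
  proof (rule ccontr)
    assume "\<not> ?thesis"
    then have "card (vanishing p J x I f) * (p ^ card J - 1) \<le> N * (p ^ card J - 1)"
      by (intro mult_right_mono) auto
    moreover have "(N * p + 1) * (p ^ d - 1) \<le> card (vanishing p J x I f) * (p ^ card J - 1)"
      using f(3) J I by simp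
    ultimately have "(N * p + 1) * (p ^ d - 1) \<le> N * (p * p ^ d - 1)"
      unfolding J(2) by (simp only: power_Suc Suc_eq_plus1[symmetric]) 
    moreover obtain q where q: "p ^ d = Suc q" using N by (cases "p ^ d") auto
    moreover obtain r where r: "p = Suc r" using prime_gt_0_nat[OF p] by (cases p) auto
    ultimately show False using N by (simp add: algebra_simps)
  qed
  then show "\<exists>A\<subseteq>I. A \<noteq> {} \<and> card A \<le> k \<and> zero_sum p J x A"
    using short_bound_kernel[where f = f, OF p b J I(1) f(1,2)] by simp
qed

lemma short_bound_geometric:
  assumes p: "prime p" and b: "short_bound p k d (M + 1)" and M: "M * (p - 1) < p ^ d - 1"
  shows "short_bound p k (d + e) (M * p ^ e + 1)"
proof (induction e)
  case 0
  then show ?case using b by simp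
next
  case (Suc e)
  have pe: "1 \<le> p ^ e" using prime_gt_0_nat[OF p] by simp
  have "M * p ^ e * (p - 1) = p ^ e * (M * (p - 1))" by simp
  also have "\<dots> < p ^ e * (p ^ d - 1)" using pe M by (intro mult_strict_left_mono) linarith+
  also have "\<dots> = p ^ (d + e) - p ^ e" by (simp add: right_diff_distrib' power_add mult.commute)
  also have "\<dots> \<le> p ^ (d + e) - 1" using pe by linarith
  finally show ?case
    using short_bound_Suc[OF p Suc.IH] by (simp add: mult_ac)
qed

lemma short_bound_2: "short_bound 2 2 d (2 ^ d + 1)"
proof (rule short_boundI)
  fix J I :: "nat set" and x :: "nat \<Rightarrow> nat \<Rightarrow> int"
  assume J: "finite J" "card J = d" and I: "finite I" "card I = 2 ^ d + 1"
  define g where "g i = (\<lambda>j\<in>J. x i j mod 2)" for i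
  have "g ` I \<subseteq> J \<rightarrow>\<^sub>E {0..<2}" by (auto simp: g_def)
  then have "card (g ` I) \<le> card (J \<rightarrow>\<^sub>E {0..<2::int})"
    using J by (intro card_mono finite_PiE) auto
  then have "card (g ` I) < card I" using J I by (simp add: card_PiE)
  then have "\<not> inj_on g I" using pigeonhole by blast
  then obtain i i' where i: "i \<in> I" "i' \<in> I" "i \<noteq> i'" "g i = g i'" by (auto simp: inj_on_def)
  have "x i j mod 2 = x i' j mod 2" if "j \<in> J" for j
    using fun_cong[OF i(4), of j] that by (simp add: g_def)
  then have "2 dvd x i j + x i' j" if "j \<in> J" for j
    using that by (metis even_add even_iff_mod_2_eq_zero)
  then have "zero_sum 2 J x {i, i'}"
    using i(3) by (simp add: zero_sum_def)
  then show "\<exists>A\<subseteq>I. A \<noteq> {} \<and> card A \<le> 2 \<and> zero_sum 2 J x A"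
    using i by (intro exI[of _ "{i, i'}"]) auto
qed

text \<open>For \<open>p = 3\<close> plain averaging falls just short; averaging only over the hyperplanes through two
  given terms on a common line, which exist by the pigeonhole principle, is enough.\<close>

lemma short_bound_3_Suc:
  assumes b: "short_bound 3 4 d (14 * q + 1)" and q: "3 ^ d = 27 * q" "1 \<le> q"
  shows "short_bound 3 4 (d + 1) (42 * q + 1)"
proof (rule short_boundI)
  fix J I :: "nat set" and x :: "nat \<Rightarrow> nat \<Rightarrow> int"
  assume J: "finite J" "card J = d + 1" and I: "finite I" "card I = 42 * q + 1"
  have p: "prime (3::nat)" by simp
  \<comment> \<open>There are \<open>2 * (42 * q + 1)\<close> signed terms but only
    \<open>3 ^ (d + 1) = 81 * q\<close> residue vectors, so two terms agree up to sign or one is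
    zero.\<close>
  define g where "g = (\<lambda>(i, b::bool). \<lambda>j\<in>J. (if b then x i j else - x i j) mod 3)"
  have "g ` (I \<times> UNIV) \<subseteq> J \<rightarrow>\<^sub>E {0..<3}" by (auto simp: g_def)
  then have "card (g ` (I \<times> UNIV)) \<le> card (J \<rightarrow>\<^sub>E {0..<3::int})"
    using J by (intro card_mono finite_PiE) auto
  also have "\<dots> = 81 * q" using J q by (simp add: card_PiE)
  also have "\<dots> < card (I \<times> (UNIV :: bool set))" using I by (simp add: card_cartesian_product)
  finally have "\<not> inj_on g (I \<times> UNIV)" using pigeonhole by blast
  then obtain i s i' s' where i: "i \<in> I" "i' \<in> I" "(i, s) \<noteq> (i', s')" "g (i, s) = g (i', s')"
    by (auto simp: inj_on_def)
  have eq: "(if s then x i j else - x i j) mod 3 = (if s' then x i' j else - x i' j) mod 3" if "j \<in> J" for j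
    using fun_cong[OF i(4), of j] that by (simp add: g_def)
  consider "zero_sum 3 J x {i}" | "i \<noteq> i'" "zero_sum 3 J x {i, i'}"
    | j where "i \<noteq> i'" "\<And>j. j \<in> J \<Longrightarrow> [x i' j = x i j] (mod 3)" "j \<in> J" "\<not> 3 dvd x i j"
  proof (cases "i = i'")
    case True
    have "3 dvd x i j" if "j \<in> J" for j
      using eq[OF that] i(3) True by (auto split: if_splits; presburger)
    then show thesis using that(1) by (auto simp: zero_sum_def)
  next
    case False
    show thesis
    proof (cases "s = s'")
      case True
      have c: "[x i' j = x i j] (mod 3)" if "j \<in> J" for j
        using eq[OF that] True unfolding cong_def by (auto split: if_splits; presburger)
      show thesis
        using that(1) that(3)[OF False c] by (auto simp: zero_sum_def)
    next
      case s: False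
      have "3 dvd x i j + x i' j" if "j \<in> J" for j
        using eq[OF that] s by (auto split: if_splits; presburger)
      then show thesis using that(2)[OF False] False by (auto simp: zero_sum_def)
    qed
  qed
  then show "\<exists>A\<subseteq>I. A \<noteq> {} \<and> card A \<le> 4 \<and> zero_sum 3 J x A"
  proof cases
    case 1
    then show ?thesis using i by (intro exI[of _ "{i}"]) auto
  next
    case 2
    then show ?thesis using i by (intro exI[of _ "{i, i'}"]) auto
  next
    case (3 j)
    \<comment> \<open>Eliminating coordinate \<open>j\<close> projects along \<open>x i\<close>;
      modulo 3 both \<open>i\<close> and \<open>i'\<close> are sent to 0.\<close>
    define y where "y t k = x i j * x t k - x t j * x i k" for t k
    define I' where "I' = I - {i, i'}"
    have I': "finite I'" "card I' = 42 * q - 1" using I i 3(1) by (auto simp: I'_def card_Diff_subset)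
    have J': "finite (J - {j})" "card (J - {j}) = d" using J 3 by auto
    have "d \<noteq> 0" using q by (intro notI) simp
    then have "J - {j} \<noteq> {}" using J' by (metis card.empty)
    then obtain f' k where f': "k \<in> J - {j}" "\<not> int 3 dvd f' k"
      "card I' * (3 ^ (card (J - {j}) - 1) - 1) \<le> card (vanishing 3 (J - {j}) y I' f') * (3 ^ card (J - {j}) - 1)"
      using heavy_hyperplane[OF p J'(1) _ I'(1)] by blast
    have "3 ^ (d - 1) = 9 * q" using q(1) \<open>d \<noteq> 0\<close> by (cases d) auto
    then have le: "(42 * q - 1) * (9 * q - 1) \<le> card (vanishing 3 (J - {j}) y I' f') * (27 * q - 1)"
      using f'(3) unfolding J' I' q by simp
    \<comment> \<open>Averaging in the quotient supplies \<open>14 * q - 1\<close> further terms;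
      \<open>i\<close> and \<open>i'\<close> bring the count to \<open>14 * q + 1\<close>.\<close>
    have n': "14 * q - 1 \<le> card (vanishing 3 (J - {j}) y I' f')"
    proof (rule ccontr)
      assume "\<not> ?thesis"
      then have "card (vanishing 3 (J - {j}) y I' f') * (27 * q - 1) \<le> (14 * q - 2) * (27 * q - 1)"
        by (intro mult_right_mono) auto
      then have "(42 * q - 1) * (9 * q - 1) \<le> (14 * q - 2) * (27 * q - 1)" using le by linarith
      moreover obtain r where "q = Suc r" using q by (cases q) auto
      ultimately show False by (simp add: algebra_simps)
    qed
    \<comment> \<open>The pullback of \<open>f'\<close> along the projection, written as a
      functional on the original coordinates.\<close>
    define f where "f = (\<lambda>k. x i j * f' k)(j := - (\<Sum>k\<in>J - {j}. f' k * x i k))"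
    have fy: "(\<Sum>k\<in>J. f k * x t k) = (\<Sum>k\<in>J - {j}. f' k * y t k)" for t
    proof -
      have "(\<Sum>k\<in>J. f k * x t k) = f j * x t j + (\<Sum>k\<in>J - {j}. f k * x t k)"
        using J 3 by (simp add: sum.remove)
      also have "(\<Sum>k\<in>J - {j}. f k * x t k) = (\<Sum>k\<in>J - {j}. f' k * (x i j * x t k))"
        by (intro sum.cong) (auto simp: f_def)
      also have "f j * x t j = - (\<Sum>k\<in>J - {j}. f' k * (x t j * x i k))"
        by (simp add: f_def sum_distrib_right sum_distrib_left mult_ac)
      finally show ?thesis
        by (simp add: y_def right_diff_distrib sum_subtractf)
    qed
    have y0: "int 3 dvd y t k" if "t \<in> {i, i'}" "k \<in> J" for t k
    proof -
      have "[x t k = x i k] (mod 3)" "[x t j = x i j] (mod 3)" using that 3 by auto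
      then have "[y t k = x i j * x i k - x i j * x i k] (mod 3)"
        unfolding y_def by (intro cong_diff cong_mult cong_refl)
      then show ?thesis by (simp add: cong_0_iff)
    qed
    have "insert i (insert i' (vanishing 3 (J - {j}) y I' f')) \<subseteq> vanishing 3 J x I f"
      using i y0 by (auto simp: vanishing_def fy I'_def intro!: dvd_sum dvd_mult)
    then have "card (insert i (insert i' (vanishing 3 (J - {j}) y I' f'))) \<le> card (vanishing 3 J x I f)"
      using I by (intro card_mono) (auto simp: vanishing_def)
    moreover have "i \<notin> vanishing 3 (J - {j}) y I' f'" "i' \<notin> vanishing 3 (J - {j}) y I' f'"
      "finite (vanishing 3 (J - {j}) y I' f')"
      using I' by (auto simp: vanishing_def I'_def)
    ultimately have "14 * q + 1 \<le> card (vanishing 3 J x I f)" using n' q 3(1) by simp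
    moreover have "\<not> int 3 dvd f k"
      using f' 3 prime_dvd_mult_iff[of "3::int" "x i j" "f' k"] by (simp add: f_def)
    moreover have "k \<in> J" using f' by simp
    ultimately show ?thesis using short_bound_kernel[where f = f and j = k, OF p b J I(1)] by blast
  qed
qed

lemma short_bound_dim3:
  assumes p: "prime p" "p \<noteq> 2" shows "short_bound p ((3 * p - 1) div 2) 3 (6 * p - 4 + 1)"
proof (rule short_boundI)
  fix J I :: "nat set" and x :: "nat \<Rightarrow> nat \<Rightarrow> int"
  assume J: "finite J" "card J = 3" and "finite I" "card I = 6 * p - 4 + 1"
  then have I: "card I = 6 * p - 3" using prime_ge_2_nat[OF p(1)] by simp
  obtain A where "A \<subseteq> I" "A \<noteq> {}" "zero_sum p J x A" "2 * card A \<le> 3 * p - 1"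
    using zero_sum_dim3[OF p J I] by blast
  then show "\<exists>A\<subseteq>I. A \<noteq> {} \<and> card A \<le> (3 * p - 1) div 2 \<and> zero_sum p J x A"
    by (intro exI[of _ A]) auto
qed

lemma short_bound_dim4:
  assumes p: "prime p" shows "short_bound p (2 * p) 4 (6 * p - 4 + 1)"
proof (rule short_boundI)
  fix J I :: "nat set" and x :: "nat \<Rightarrow> nat \<Rightarrow> int"
  assume J: "finite J" "card J = 4" and "finite I" "card I = 6 * p - 4 + 1"
  then have I: "card I = 6 * p - 3" using prime_ge_2_nat[OF p(1)] by simp
  show "\<exists>A\<subseteq>I. A \<noteq> {} \<and> card A \<le> 2 * p \<and> zero_sum p J x A"
  proof (cases "p = 3")
    case True
    then have "card I = 15" using I by simp
    then obtain A where "A \<subseteq> I" "A \<noteq> {}" "zero_sum 3 J x A" "card A \<le> 6"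
      by (rule zero_sum_dim4_3[OF J])
    then show ?thesis using True by auto
  next
    case False
    then show ?thesis using zero_sum_dim4[OF p False J I] by metis
  qed
qed

lemma short_bound_first:
  assumes p: "prime p" shows "short_bound p ((3 * p - 1) div 2) (3 + e) ((6 * p - 4) * p ^ e + 1)"
proof -
  \<comment> \<open>The averaging condition \<open>(6 * p - 4) * (p - 1) < p ^ 3 - 1\<close> fails
    for \<open>p = 3\<close>, where it reads \<open>28 < 26\<close>, and holds from 5 on. For
    \<open>p = 2\<close> the length is \<open>2 ^ (3 + e) + 1\<close>, as pigeonhole
    requires.\<close>
  consider "p = 2" | "p = 3" | "5 \<le> p"
  proof -
    have "p \<noteq> 4" using p by auto
    then show thesis using that prime_ge_2_nat[OF p] by linarith
  qed
  then show ?thesis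
  proof cases
    case 1
    then show ?thesis using short_bound_2[of "3 + e"] by (simp add: power_add)
  next
    case 2
    have "short_bound 3 4 (3 + e) (14 * 3 ^ e + 1)"
    proof (induction e)
      case 0
      then show ?case using short_bound_dim3[of 3] by simp
    next
      case (Suc e)
      then show ?case using short_bound_3_Suc[of "3 + e" "3 ^ e"] by (simp add: power_add)
    qed
    then show ?thesis using 2 by simp
  next
    case 3
    have "(6 * p - 4) * (p - 1) < p ^ 3 - 1"
    proof -
      obtain r where r: "p = r + 5" using 3 by (metis add.commute le_Suc_ex)
      show ?thesis unfolding r by (simp add: power3_eq_cube algebra_simps)
    qed
    then show ?thesis using short_bound_geometric[OF p short_bound_dim3] p 3 by simp
  qed
qed

lemma short_bound_second:
  assumes p: "prime p" shows "short_bound p (2 * p) (4 + e) ((6 * p - 4) * p ^ e + 1)"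
proof (rule short_bound_geometric[OF p short_bound_dim4[OF p]])
  obtain r where r: "p = r + 2" using prime_ge_2_nat[OF p] by (metis add.commute le_Suc_ex)
  show "(6 * p - 4) * (p - 1) < p ^ 4 - 1" unfolding r by (simp add: power4_eq_xxxx algebra_simps)
qed

section \<open>Return to sequences in \<open>Zmod_power\<close>\<close>

lemma comm_group_Zmod_power: "comm_group (Zmod_power p d)"
  unfolding Zmod_power_def
proof (rule group.group_comm_groupI)
  show "group (product_group {..<d} (\<lambda>_. integer_mod_group p))" by simp
qed (auto simp: add.commute)

lemma finprod_Zmod_power:
  assumes p: "0 < p" and I: "finite I" and x: "\<And>i. i \<in> I \<Longrightarrow> x i \<in> carrier (Zmod_power p d)"
  shows "finprod (Zmod_power p d) x I = (\<lambda>j\<in>{..<d}. (\<Sum>i\<in>I. x i j) mod int p)"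
proof -
  interpret comm_group "Zmod_power p d" by (rule comm_group_Zmod_power)
  show ?thesis
    using I x
  proof (induction I rule: finite_induct)
    case empty
    then show ?case by (subst finprod_empty) (simp add: Zmod_power_def)
  next
    case (insert i I)
    then have "finprod (Zmod_power p d) x (insert i I) = x i \<otimes>\<^bsub>Zmod_power p d\<^esub> finprod (Zmod_power p d) x I"
      by (intro finprod_insert) auto
    then show ?case
      using insert by (auto simp: Zmod_power_def fun_eq_iff mod_simps)
  qed
qed

lemma has_zero_sum_subseq_iff:
  assumes p: "0 < p" and xs: "set xs \<subseteq> carrier (Zmod_power p d)"
  shows "has_zero_sum_subseq (Zmod_power p d) xs l \<longleftrightarrow>
    1 \<le> l \<and> (\<exists>I\<subseteq>{..<length xs}. card I = l \<and> zero_sum p {..<d} (\<lambda>i. xs ! i) I)"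
proof -
  have "finprod (Zmod_power p d) (\<lambda>i. xs ! i) I = \<one>\<^bsub>Zmod_power p d\<^esub> \<longleftrightarrow> zero_sum p {..<d} (\<lambda>i. xs ! i) I"
    if I: "I \<subseteq> {..<length xs}" for I
  proof -
    have "finprod (Zmod_power p d) (\<lambda>i. xs ! i) I = (\<lambda>j\<in>{..<d}. (\<Sum>i\<in>I. (xs ! i) j) mod int p)"
      using I xs finite_subset[OF I] by (intro finprod_Zmod_power[OF p]) (auto simp: subset_iff)
    then show ?thesis
      by (auto simp: Zmod_power_def zero_sum_def fun_eq_iff dvd_eq_mod_eq_0 restrict_def)
  qed
  then show ?thesis unfolding has_zero_sum_subseq_def by blast
qed

lemma short_bound_has_zero_sum_subseq:
  assumes p: "0 < p" and b: "short_bound p k d n"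
    and xs: "set xs \<subseteq> carrier (Zmod_power p d)" "length xs = n"
  obtains l where "has_zero_sum_subseq (Zmod_power p d) xs l" "l \<le> k"
proof -
  obtain A where A: "A \<subseteq> {..<length xs}" "A \<noteq> {}" "card A \<le> k" "zero_sum p {..<d} (\<lambda>i. xs ! i) A"
    using b xs(2) unfolding short_bound_def by (metis card_lessThan finite_lessThan order_refl)
  have "1 \<le> card A" using A finite_subset[OF A(1)] by (simp add: Suc_le_eq card_gt_0_iff)
  then show thesis using that[of "card A"] A has_zero_sum_subseq_iff[OF p xs(1)] by blast
qed

theorem theorem1p3:
  fixes p d :: nat
  assumes "prime p" and "d \<ge> 3"
  shows "(\<forall>xs. set xs \<subseteq> carrier (Zmod_power p d) \<and> length xs = (6 * p - 4) * p ^ (d - 3) + 1 \<longrightarrow>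
            (\<exists>l. has_zero_sum_subseq (Zmod_power p d) xs l \<and> real l \<le> (3 * real p - 1) / 2)) \<and>
         (d \<ge> 4 \<longrightarrow>
          (\<forall>xs. set xs \<subseteq> carrier (Zmod_power p d) \<and> length xs = (6 * p - 4) * p ^ (d - 4) + 1 \<longrightarrow>
            (\<exists>l. has_zero_sum_subseq (Zmod_power p d) xs l \<and> l \<le> 2 * p)))"
proof (intro conjI allI impI; elim conjE)
  have p0: "0 < p" using assms(1) prime_gt_0_nat by blast
  fix xs assume xs: "set xs \<subseteq> carrier (Zmod_power p d)"
  {
    assume "length xs = (6 * p - 4) * p ^ (d - 3) + 1"
    moreover have "short_bound p ((3 * p - 1) div 2) d ((6 * p - 4) * p ^ (d - 3) + 1)"
      using short_bound_first[OF assms(1), of "d - 3"] assms(2) by simp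
    ultimately obtain l where l: "has_zero_sum_subseq (Zmod_power p d) xs l" "l \<le> (3 * p - 1) div 2"
      using short_bound_has_zero_sum_subseq[OF p0 _ xs] by blast
    have "2 * l + 1 \<le> 3 * p" using l(2) p0 by linarith
    then have "real (2 * l + 1) \<le> real (3 * p)" by (simp only: of_nat_le_iff)
    then show "\<exists>l. has_zero_sum_subseq (Zmod_power p d) xs l \<and> real l \<le> (3 * real p - 1) / 2"
      using l(1) by (intro exI[of _ l]) (simp add: field_simps)
  next
    assume "4 \<le> d" and "length xs = (6 * p - 4) * p ^ (d - 4) + 1"
    moreover have "short_bound p (2 * p) d ((6 * p - 4) * p ^ (d - 4) + 1)"
      using short_bound_second[OF assms(1), of "d - 4"] \<open>4 \<le> d\<close> by simp
    ultimately show "\<exists>l. has_zero_sum_subseq (Zmod_power p d) xs l \<and> l \<le> 2 * p"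
      using short_bound_has_zero_sum_subseq[OF p0 _ xs] by blast
  }
qed

end
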